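(* Let $\gamma\in(-1,1)$ and $B(x)=x^\gamma$ for $x\ge1$. Let $f:[0,\infty)\to\mathbb{R}$ be a nondecreasing $C^3$ function with $f(0)>1$. Consider the diffusion process $X(t)$ corresponding to the generator $\frac12\frac{d^2}{dx^2}+B(x)\frac{d}{dx}$ in the time-dependent domain $(1,f(t))$, with reflection at both the fixed endpoint $1$ and the time-dependent endpoint $f(t)$. (i) Assume that $f(t)=(\log t)^l$ for all sufficiently large $t$, with $l>\frac1{1+\gamma}$. Then $$\lim_{t\to\infty}\frac{X(t)}{f(t)}=1\quad\text{a.s.}$$ (ii) Assume that $f(t)=t^l$ for all sufficiently large $t$, with $l\in\big(0,\frac1{1-\gamma}\big)$. Let $$q_0=\begin{cases}0,&\text{if }\gamma\ge0;\\ -l\gamma,&\text{if }\gamma\in(-1,0).\end{cases}$$ Then $$\limsup_{t\to\infty}\frac{f(t)-X(t)}{t^q}=0\quad\text{a.s., for every } q>q_0,$$ and $$\limsup_{t\to\infty}\frac{f(t)-X(t)}{t^{q_0}}=\infty\quad\text{a.s., when }\gamma\in(-1,0].$$ In particular, $$\lim_{t\to\infty}\frac{X(t)}{f(t)}=1\quad\text{a.s.}$$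
   Context: The one-dimensional reflected process: started at time $s\ge0$ from $x\in[1,f(s)]$, it is a continuous process with $X(t)\in[1,f(t)]$ for $t\ge s$, satisfying $$X(t)=x+W(t)-W(s)+\int_s^tB(X(u))\,du+\mathcal{L}^{1}_t-\mathcal{L}^{f}_t,$$ where $W$ is a Brownian motion, and $\mathcal{L}^1,\mathcal{L}^f$ are continuous nondecreasing processes, zero at time $s$, with $\mathcal{L}^1$ increasing only when $X(u)=1$ and $\mathcal{L}^f$ increasing only when $X(u)=f(u)$ (boundary local times). "A.s." refers to the law of this process from any starting point. *)

theory Defs
  imports "HOL-Probability.Probability"
begin

text \<open>
  \<open>C_k_on k S f\<close>: the derivatives of \<open>f\<close> on \<open>S\<close> up to order \<open>k\<close> exist and are continuous.
  Derivatives are taken within \<open>S\<close>, hence one-sided at an endpoint contained in \<open>S\<close>.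
\<close>

definition C_k_on :: "nat \<Rightarrow> real set \<Rightarrow> (real \<Rightarrow> real) \<Rightarrow> bool" where
  "C_k_on k S f \<longleftrightarrow>
     (\<exists>D. D 0 = f \<and>
        (\<forall>i<k. \<forall>t\<in>S. (D i has_real_derivative D (Suc i) t) (at t within S)) \<and>
        continuous_on S (D k))"

text \<open>Time runs over \<open>[0,\<infinity>)\<close>; the values \<open>W t\<close> for \<open>t < 0\<close> are irrelevant.\<close>

locale brownian_motion = prob_space M for M :: "'a measure" +
  fixes W :: "real \<Rightarrow> 'a \<Rightarrow> real"
  assumes random_variable_W: "\<And>t. 0 \<le> t \<Longrightarrow> random_variable borel (W t)"
    and W_0: "AE \<omega> in M. W 0 \<omega> = 0"
    and normal_increments: "\<And>u t. 0 \<le> u \<Longrightarrow> u < t \<Longrightarrow>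
          distributed M lborel (\<lambda>\<omega>. W t \<omega> - W u \<omega>)
            (\<lambda>y. ennreal (normal_density 0 (sqrt (t - u)) y))"
    and indep_increments: "\<And>(\<tau> :: nat \<Rightarrow> real) n. 0 \<le> \<tau> 0 \<Longrightarrow> strict_mono \<tau> \<Longrightarrow>
          indep_vars (\<lambda>_. borel) (\<lambda>i \<omega>. W (\<tau> (Suc i)) \<omega> - W (\<tau> i) \<omega>) {..<n}"
    and continuous_W: "AE \<omega> in M. continuous_on {0..} (\<lambda>t. W t \<omega>)"

text \<open>
  \<open>l\<close> is a continuous nondecreasing function on \<open>[s,\<infinity>)\<close>, zero at \<open>s\<close>, which increases only on
  the set \<open>Z\<close>: its Lebesgue--Stieltjes measure does not charge the complement of \<open>Z\<close>.
  The function \<open>\<lambda>u. l (max s u)\<close> extends \<open>l\<close> by the constant \<open>l s\<close> to the left of \<open>s\<close>,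
  so that the library's Stieltjes measure on the whole line applies.
\<close>

definition increases_only_on :: "real \<Rightarrow> (real \<Rightarrow> real) \<Rightarrow> real set \<Rightarrow> bool" where
  "increases_only_on s l Z \<longleftrightarrow>
     l s = 0 \<and> mono_on {s..} l \<and> continuous_on {s..} l \<and>
     (AE u in interval_measure (\<lambda>u. l (max s u)). s \<le> u \<longrightarrow> u \<in> Z)"

text \<open>
  The diffusion with generator \<open>1/2 d\<^sup>2/dx\<^sup>2 + B d/dx\<close> in \<open>(1, f t)\<close>, reflected at both endpoints
  and started at time \<open>s\<close> from \<open>x\<close>. \<open>L1\<close> and \<open>Lf\<close> are the boundary local times at \<open>1\<close> and \<open>f\<close>.
  The path properties are required almost surely.
\<close>

locale reflected_diffusion = brownian_motion M W
  for M :: "'a measure" and W :: "real \<Rightarrow> 'a \<Rightarrow> real" +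
  fixes B f :: "real \<Rightarrow> real" and s x :: real and X L1 Lf :: "real \<Rightarrow> 'a \<Rightarrow> real"
  assumes random_variable_X: "\<And>t. s \<le> t \<Longrightarrow> random_variable borel (X t)"
    and random_variable_L1: "\<And>t. s \<le> t \<Longrightarrow> random_variable borel (L1 t)"
    and random_variable_Lf: "\<And>t. s \<le> t \<Longrightarrow> random_variable borel (Lf t)"
    and continuous_X: "AE \<omega> in M. continuous_on {s..} (\<lambda>t. X t \<omega>)"
    and range_X: "AE \<omega> in M. \<forall>t\<ge>s. X t \<omega> \<in> {1..f t}"
    and X_eq: "AE \<omega> in M. \<forall>t\<ge>s.
          X t \<omega> = x + W t \<omega> - W s \<omega> + integral {s..t} (\<lambda>u. B (X u \<omega>)) + L1 t \<omega> - Lf t \<omega>"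
    and local_time_1: "AE \<omega> in M. increases_only_on s (\<lambda>t. L1 t \<omega>) {u. X u \<omega> = 1}"
    and local_time_f: "AE \<omega> in M. increases_only_on s (\<lambda>t. Lf t \<omega>) {u. X u \<omega> = f u}"

end

theory Submission
  imports Defs "HOL-Real_Asymp.Real_Asymp"
begin

text \<open>
  The whole argument is pathwise. The only probabilistic input concerns the Brownian motion \<open>W\<close>:
  Gaussian tails with the Borel--Cantelli lemma for the upper bounds, and independence of increments
  over disjoint intervals for the lower bound.

  Upper bound. While \<open>X < f\<close>, the upper local time is constant, the lower one can only push \<open>X\<close>
  up, and so \<open>X\<close> rises at least by its drift plus the noise. If moreover \<open>X \<ge> f / 2\<close>, the drift
  \<open>X powr \<gamma>\<close> is comparable to \<open>f powr \<gamma>\<close>, whatever the sign of \<open>\<gamma>\<close>. In both regimes of the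
  theorem \<open>f'\<close> is negligible against \<open>f powr \<gamma>\<close>: this is where \<open>l < 1 / (1 - \<gamma>)\<close> enters for
  the powers. So after the last visit \<open>r\<close> of \<open>X\<close> to \<open>f\<close> before time \<open>t\<close>, the distance
  satisfies \<open>f t - X t \<le> W r - W t - \<kappa> * (t - r) * f t powr \<gamma>\<close>. The right-hand side is at most
  the maximal drawdown of a Brownian motion against the slope \<open>\<beta> = \<kappa> * f t powr \<gamma>\<close>; it exceeds
  \<open>z\<close> with probability about \<open>exp (- 2 * \<beta> * z)\<close>, which is summable over integer times as soon
  as \<open>z t * f t powr \<gamma>\<close> outgrows \<open>ln t\<close> (\<open>drawdown\<close>). Thus \<open>f - X \<le> z\<close> eventually for every
  such \<open>z\<close> with \<open>z / f \<longlongrightarrow> 0\<close> (\<open>distance_to_boundary\<close>). For \<open>f = (ln t) powr l\<close> there is room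
  for such a \<open>z\<close> exactly when \<open>l * (1 + \<gamma>) > 1\<close>, and for \<open>f = t powr l\<close> any power
  \<open>t powr p\<close> with \<open>max 0 (- l * \<gamma>) < p < l\<close> will do.

  This scheme starts only once \<open>X\<close> has come up to \<open>f\<close> at a late time. It does, because without the
  upper barrier \<open>X\<close> would grow like \<open>t powr (1 / (1 - \<gamma>))\<close> by its drift alone, faster than \<open>f\<close>,
  while the noise is of smaller order (\<open>reaches_boundary\<close>).

  Lower bound, for \<open>\<gamma> \<le> 0\<close>. Put \<open>a = - l * \<gamma>\<close>. In a time interval of length
  \<open>u powr (2 * a)\<close> starting at \<open>u\<close>, the Brownian increment and the accumulated drift both have
  the order \<open>u powr a\<close>. Given any \<open>m\<close>, the increment falls below \<open>- m * u powr a\<close> with a positive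
  probability that does not depend on \<open>u\<close>; on disjoint intervals these events are independent, so
  almost surely infinitely many of them occur (\<open>infinitely_many_drops\<close>), and each of them pulls
  \<open>X\<close> down by about \<open>m * u powr a\<close>.
\<close>

section \<open>Reflected paths\<close>

lemma last_zero:
  fixes g :: "real \<Rightarrow> real"
  assumes "a \<le> b" "continuous_on {a..b} g" "g a \<le> 0" "g b > 0"
  shows "\<exists>r\<in>{a..<b}. g r = 0 \<and> (\<forall>u\<in>{r<..b}. g u > 0)"
proof -
  define S where "S = {a..b} \<inter> g -` {..0}"
  have S: "a \<in> S" "closed S" "S \<subseteq> {a..b}" "bdd_above S"
    using assms continuous_closed_preimage[OF assms(2), of "{..0}"]
    by (auto simp: S_def intro: bdd_above_mono[OF bdd_above_Icc])
  define r where "r = Sup S"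
  have r: "r \<in> S" unfolding r_def using S by (intro closed_contains_Sup) auto
  have pos: "g u > 0" if "u \<in> {r<..b}" for u
  proof (rule ccontr)
    assume "\<not> ?thesis"
    then have "u \<in> S" using that r S(3) by (auto simp: S_def)
    then show False using cSup_upper[OF _ S(4)] that by (force simp: r_def)
  qed
  have rb: "r < b" using r assms by (force simp: S_def order_le_less)
  have "\<exists>v\<ge>r. v \<le> b \<and> g v = 0"
    using r assms by (intro IVT') (auto simp: S_def intro: continuous_on_subset)
  then obtain v where v: "r \<le> v" "v \<le> b" "g v = 0" by auto
  then have "v = r" using pos[of v] by force
  then show ?thesis using v pos rb r S(3) by (intro bexI[of _ r]) auto
qed

lemma first_zero:
  fixes g :: "real \<Rightarrow> real"
  assumes "a \<le> b" "continuous_on {a..b} g" "g a > 0" "g b \<le> 0"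
  shows "\<exists>r\<in>{a<..b}. g r = 0 \<and> (\<forall>u\<in>{a..<r}. g u > 0)"
proof -
  have "continuous_on {-b..-a} (\<lambda>u. g (- u))"
    by (rule continuous_on_compose2[OF assms(2)]) (auto intro!: continuous_intros)
  then obtain r where r: "r \<in> {-b..<-a}" "g (-r) = 0" "\<And>u. u \<in> {r<..-a} \<Longrightarrow> g (-u) > 0"
    using last_zero[of "-b" "-a" "\<lambda>u. g (- u)"] assms by auto
  show ?thesis
  proof (intro bexI[of _ "-r"] conjI ballI)
    fix u assume "u \<in> {a..<-r}"
    then show "g u > 0" using r(3)[of "-u"] by auto
  qed (use r in auto)
qed

text \<open>
  The Stieltjes measure of \<open>{r<..t}\<close> is \<open>l t - l r\<close>, and this interval lies in the null set on which
  \<open>l\<close> is known not to increase. The interval is open at \<open>r\<close>, so that \<open>r\<close> itself may be a visit to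
  \<open>Z\<close>: below, \<open>r\<close> will be the last visit to the boundary.
\<close>

lemma increases_only_on_constant:
  assumes l: "increases_only_on s l Z" and "s \<le> r" "r \<le> t"
    and Z: "\<And>u. u \<in> {r<..t} \<Longrightarrow> u \<notin> Z"
  shows "l t = l r"
proof -
  define F where "F = (\<lambda>u. l (max s u))"
  have mono: "F a \<le> F b" if "a \<le> b" for a b
    using l that by (auto simp: F_def increases_only_on_def intro!: mono_onD[of "{s..}" l])
  have "continuous_on UNIV F"
    unfolding F_def using l
    by (auto simp: increases_only_on_def intro!: continuous_intros intro: continuous_on_compose2[of "{s..}" l])
  then have cont: "continuous (at_right a) F" for a
    by (simp add: continuous_on_eq_continuous_at continuous_at_imp_continuous_at_within)
  obtain N where N: "N \<in> null_sets (interval_measure F)"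
      "{u \<in> space (interval_measure F). \<not> (s \<le> u \<longrightarrow> u \<in> Z)} \<subseteq> N"
    using l unfolding increases_only_on_def F_def[symmetric] eventually_ae_filter by blast
  have "{r<..t} \<subseteq> N"
  proof
    fix u assume "u \<in> {r<..t}"
    then show "u \<in> N" using N(2) Z[of u] assms(2) by (auto simp: subset_iff)
  qed
  then have "{r<..t} \<in> null_sets (interval_measure F)"
    by (intro null_sets_subset[OF N(1)]) auto
  then have "emeasure (interval_measure F) {r<..t} = 0" by auto
  then have "ennreal (F t - F r) = 0"
    using emeasure_interval_measure_Ioc[of r t F] mono cont assms(3) by simp
  then have "F t \<le> F r" by (simp add: ennreal_eq_0_iff)
  then have "F t = F r" using mono[OF assms(3)] by simp
  then show ?thesis using assms by (simp add: F_def max_def)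
qed

text \<open>
  A single path of the reflected process. The driving function \<open>W\<close> is arbitrary here; a Brownian
  path is substituted for it only when the estimates are combined.
\<close>

locale reflected_path =
  fixes B f W X L1 Lf :: "real \<Rightarrow> real" and s x :: real
  assumes continuous_B: "continuous_on {1..} B"
    and continuous_path: "continuous_on {s..} X"
    and range_path: "\<And>t. s \<le> t \<Longrightarrow> X t \<in> {1..f t}"
    and path_eq: "\<And>t. s \<le> t \<Longrightarrow>
          X t = x + W t - W s + integral {s..t} (\<lambda>u. B (X u)) + L1 t - Lf t"
    and local_time_1: "increases_only_on s L1 {u. X u = 1}"
    and local_time_f: "increases_only_on s Lf {u. X u = f u}"
begin

lemma continuous_drift: "s \<le> r \<Longrightarrow> continuous_on {r..t} (\<lambda>u. B (X u))"
  by (rule continuous_on_compose2[OF continuous_B])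
     (use range_path in \<open>force intro: continuous_on_subset[OF continuous_path]\<close>)+

lemma drift_integrable: "s \<le> r \<Longrightarrow> (\<lambda>u. B (X u)) integrable_on {r..t}"
  by (intro integrable_continuous_real continuous_drift)

lemma path_increment:
  assumes "s \<le> r" "r \<le> t"
  shows "X t - X r = W t - W r + integral {r..t} (\<lambda>u. B (X u)) + (L1 t - L1 r) - (Lf t - Lf r)"
  using path_eq[of r] path_eq[of t] assms
    Henstock_Kurzweil_Integration.integral_combine[OF assms drift_integrable[of s t]] by simp

lemma path_increment_ge:
  assumes "s \<le> r" "r \<le> t" "\<And>u. u \<in> {r<..t} \<Longrightarrow> X u < f u"
  shows "X t - X r \<ge> W t - W r + integral {r..t} (\<lambda>u. B (X u))"
proof -
  have "Lf t = Lf r"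
    by (rule increases_only_on_constant[OF local_time_f]) (use assms in force)+
  moreover have "L1 r \<le> L1 t"
    using local_time_1 assms by (auto simp: increases_only_on_def intro: mono_onD)
  ultimately show ?thesis using path_increment[OF assms(1,2)] by simp
qed

lemma path_increment_le:
  assumes "s \<le> r" "r \<le> t" "\<And>u. u \<in> {r<..t} \<Longrightarrow> X u > 1"
  shows "X t - X r \<le> W t - W r + integral {r..t} (\<lambda>u. B (X u))"
proof -
  have "L1 t = L1 r"
    by (rule increases_only_on_constant[OF local_time_1]) (use assms in force)+
  moreover have "Lf r \<le> Lf t"
    using local_time_f assms by (auto simp: increases_only_on_def intro: mono_onD)
  ultimately show ?thesis using path_increment[OF assms(1,2)] by simp
qed

end

section \<open>Slowly moving boundaries\<close>

text \<open>
  These conditions hold both for powers and for powers of the logarithm. That \<open>f'\<close> is small against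
  \<open>f powr \<gamma>\<close> makes a process close to the boundary catch up with it. The doubling condition bounds
  the drift near the boundary at an earlier time by the drift now. That \<open>f\<close> is small against
  \<open>t powr (1 / (1 - \<gamma>))\<close>, the growth of the solutions of \<open>y' = y powr \<gamma>\<close>, forces the process to
  reach the boundary in the first place.
\<close>

locale slow_boundary =
  fixes f f' :: "real \<Rightarrow> real" and \<gamma> :: real
  assumes gamma: "-1 < \<gamma>" "\<gamma> < 1"
    and f_mono: "mono_on {0..} f"
    and f_0: "f 0 > 1"
    and f_deriv: "\<forall>\<^sub>F t in at_top. (f has_real_derivative f' t) (at t)"
    and f'_small: "((\<lambda>t. f' t / f t powr \<gamma>) \<longlongrightarrow> 0) at_top"
    and f_doubling: "\<exists>K. \<forall>\<^sub>F t in at_top. f (2 * t) \<le> K * f t"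
    and f_small: "((\<lambda>t. f t / t powr (1 / (1 - \<gamma>))) \<longlongrightarrow> 0) at_top"
begin

lemma f_gt_1: "0 \<le> t \<Longrightarrow> f t > 1"
  using mono_onD[OF f_mono, of 0 t] f_0 by force

lemma f_mono': "0 \<le> r \<Longrightarrow> r \<le> t \<Longrightarrow> f r \<le> f t"
  using mono_onD[OF f_mono] by auto

lemma continuous_f: "\<exists>N\<ge>0. continuous_on {N..} f"
proof -
  obtain N where "\<And>t. t \<ge> N \<Longrightarrow> (f has_real_derivative f' t) (at t)"
    using f_deriv unfolding eventually_at_top_linorder by auto
  then have "continuous_on {max N 0..} f"
    by (intro continuous_at_imp_continuous_on) (meson DERIV_isCont atLeast_iff max.bounded_iff)
  then show ?thesis by (intro exI[of _ "max N 0"]) auto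
qed

lemma continuous_boundary_drift:
  assumes "continuous_on {N..} f" "N \<ge> 0" "r \<ge> N"
  shows "continuous_on {r..t} (\<lambda>u. f u powr \<gamma>)"
proof (intro continuous_on_powr continuous_on_subset[OF assms(1)] continuous_on_const ballI)
  fix u assume "u \<in> {r..t}"
  then show "f u \<noteq> 0" using assms f_gt_1[of u] by auto
qed (use assms in auto)

lemma doubling_constant:
  obtains K N where "K \<ge> 1" "N \<ge> 0" "\<And>t. t \<ge> N \<Longrightarrow> f (2 * t) \<le> K * f t"
proof -
  obtain K N where K: "\<And>t. t \<ge> N \<Longrightarrow> f (2 * t) \<le> K * f t"
    using f_doubling unfolding eventually_at_top_linorder by auto
  have "f (2 * t) \<le> max K 1 * f t" if "t \<ge> max N 0" for t
  proof -
    have "K * f t \<le> max K 1 * f t" using f_gt_1[of t] that by (intro mult_right_mono) auto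
    then show ?thesis using K[of t] that by simp
  qed
  then show thesis using that[of "max K 1" "max N 0"] by auto
qed

text \<open>
  For \<open>\<gamma> \<le> 0\<close> the drift \<open>f powr \<gamma>\<close> at the boundary decreases in time, so its average over an
  interval is at least its final value. For \<open>\<gamma> > 0\<close> it increases, and the second half of the
  interval suffices: it lies to the right of \<open>t / 2\<close>, where doubling applies.
\<close>

lemma average_drift:
  "\<exists>\<kappa>>0. \<exists>N\<ge>0. continuous_on {N..} f \<and>
     (\<forall>r\<ge>N. \<forall>t\<ge>r. \<kappa> * (t - r) * f t powr \<gamma> \<le> integral {r..t} (\<lambda>u. f u powr \<gamma>))"
proof -
  obtain N1 where N1: "N1 \<ge> 0" "continuous_on {N1..} f" using continuous_f by auto
  obtain K N2 where K: "K \<ge> 1" "N2 \<ge> 0" "\<And>t. t \<ge> N2 \<Longrightarrow> f (2 * t) \<le> K * f t"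
    using doubling_constant by blast
  define N where "N = max N1 (2 * N2)"
  have cf: "continuous_on {N..} f" using N1 by (auto simp: N_def intro: continuous_on_subset)
  have c: "continuous_on {r..t} (\<lambda>u. f u powr \<gamma>)" if "r \<ge> N" for r t
    using continuous_boundary_drift[OF cf _ that] N1 by (simp add: N_def)
  show ?thesis
  proof (cases "\<gamma> \<le> 0")
    case True
    have "1 * (t - r) * f t powr \<gamma> \<le> integral {r..t} (\<lambda>u. f u powr \<gamma>)" if "r \<ge> N" "r \<le> t" for r t
    proof -
      have "integral {r..t} (\<lambda>u. f t powr \<gamma>) \<le> integral {r..t} (\<lambda>u. f u powr \<gamma>)"
      proof (rule integral_le)
        fix u assume "u \<in> {r..t}"
        then have "0 \<le> u" "u \<le> t" using that N1 by (auto simp: N_def)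
        then show "f t powr \<gamma> \<le> f u powr \<gamma>"
          using True f_gt_1[of u] f_mono'[of u t] by (intro powr_mono2') auto
      qed (auto intro!: integrable_continuous_real c that)
      then show ?thesis using that by simp
    qed
    then show ?thesis using cf N1 by (intro exI[of _ 1] conjI exI[of _ N]) (auto simp: N_def)
  next
    case False
    have "(K powr - \<gamma> / 2) * (t - r) * f t powr \<gamma> \<le> integral {r..t} (\<lambda>u. f u powr \<gamma>)"
      if "r \<ge> N" "r \<le> t" for r t
    proof -
      define m where "m = (r + t) / 2"
      have m: "r \<le> m" "m \<le> t" "t / 2 \<le> m" using that N1 by (auto simp: m_def N_def)
      have nn: "0 \<le> t / 2" "N2 \<le> t / 2" using that N1 by (auto simp: N_def)
      have "integral {m..t} (\<lambda>u. K powr - \<gamma> * f t powr \<gamma>) \<le> integral {m..t} (\<lambda>u. f u powr \<gamma>)"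
      proof (rule integral_le)
        fix u assume u: "u \<in> {m..t}"
        have "f t \<le> K * f (t / 2)" using K(3)[of "t/2"] nn by simp
        also have "\<dots> \<le> K * f u" using K(1) u m nn by (intro mult_left_mono f_mono') auto
        finally have "f t powr \<gamma> \<le> (K * f u) powr \<gamma>"
          using False f_gt_1[of t] nn by (intro powr_mono2) auto
        also have "\<dots> = K powr \<gamma> * f u powr \<gamma>" using K(1) f_gt_1[of u] u m nn by (intro powr_mult) 
        finally show "K powr - \<gamma> * f t powr \<gamma> \<le> f u powr \<gamma>"
          using K(1) by (simp add: powr_minus field_simps)
      qed (use m that in \<open>auto intro!: integrable_continuous_real c\<close>)
      also have "\<dots> \<le> integral {r..m} (\<lambda>u. f u powr \<gamma>) + integral {m..t} (\<lambda>u. f u powr \<gamma>)"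
        using c[of r m] that by (simp add: integral_nonneg integrable_continuous_real)
      also have "\<dots> = integral {r..t} (\<lambda>u. f u powr \<gamma>)"
        using m that by (intro Henstock_Kurzweil_Integration.integral_combine integrable_continuous_real c) auto
      finally show ?thesis using m by (simp add: m_def field_simps)
    qed
    then show ?thesis using K(1) cf N1
      by (intro exI[of _ "K powr - \<gamma> / 2"] conjI exI[of _ N]) (auto simp: N_def)
  qed
qed

text \<open>
  Half of the drift pays for the rise of the boundary, as \<open>f'\<close> is eventually below
  \<open>c / 2 * f powr \<gamma>\<close>; the other half remains as a linear gain.
\<close>

lemma drift_beats_boundary:
  assumes "c > 0"
  shows "\<exists>\<kappa>>0. \<exists>N\<ge>0. continuous_on {N..} f \<and>
     (\<forall>r\<ge>N. \<forall>t\<ge>r. f t - f r + \<kappa> * (t - r) * f t powr \<gamma> \<le> c * integral {r..t} (\<lambda>u. f u powr \<gamma>))"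
proof -
  obtain \<kappa> N1 where k: "\<kappa> > 0" "N1 \<ge> 0" "continuous_on {N1..} f"
     "\<And>r t. r \<ge> N1 \<Longrightarrow> t \<ge> r \<Longrightarrow> \<kappa> * (t - r) * f t powr \<gamma> \<le> integral {r..t} (\<lambda>u. f u powr \<gamma>)"
    using average_drift by blast
  have "\<forall>\<^sub>F t in at_top. f' t / f t powr \<gamma> < c / 2"
    using order_tendstoD(2)[OF f'_small, of "c/2"] assms by simp
  then have "\<forall>\<^sub>F t in at_top. (f has_real_derivative f' t) (at t) \<and> f' t / f t powr \<gamma> < c / 2"
    using f_deriv by eventually_elim auto
  then obtain N2 where N2: "\<And>t. t \<ge> N2 \<Longrightarrow> (f has_real_derivative f' t) (at t)"
     "\<And>t. t \<ge> N2 \<Longrightarrow> f' t / f t powr \<gamma> < c / 2"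
    unfolding eventually_at_top_linorder by auto
  define N where "N = max N1 N2"
  have "f t - f r + c * \<kappa> / 2 * (t - r) * f t powr \<gamma> \<le> c * integral {r..t} (\<lambda>u. f u powr \<gamma>)"
    if rt: "r \<ge> N" "t \<ge> r" for r t
  proof -
    have c: "continuous_on {r..t} (\<lambda>u. f u powr \<gamma>)"
      using continuous_boundary_drift[OF k(3,2)] rt by (simp add: N_def)
    have "f t - f r \<le> c / 2 * integral {r..t} (\<lambda>u. f u powr \<gamma>)"
    proof (rule has_integral_le)
      show "(f' has_integral f t - f r) {r..t}"
        using rt N2(1) by (intro fundamental_theorem_of_calculus)
          (auto simp: N_def has_real_derivative_iff_has_vector_derivative[symmetric]
            intro: has_field_derivative_at_within)
      show "((\<lambda>u. c / 2 * f u powr \<gamma>) has_integral c / 2 * integral {r..t} (\<lambda>u. f u powr \<gamma>)) {r..t}"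
        by (intro has_integral_mult_right integrable_integral integrable_continuous_real c)
      fix u assume "u \<in> {r..t}"
      then have "u \<ge> N2" "f u > 1" using rt k(2) f_gt_1[of u] by (auto simp: N_def)
      then show "f' u \<le> c / 2 * f u powr \<gamma>" using N2(2)[of u] by (simp add: field_simps)
    qed
    moreover have "c / 2 * (\<kappa> * (t - r) * f t powr \<gamma>) \<le> c / 2 * integral {r..t} (\<lambda>u. f u powr \<gamma>)"
      using k(4)[of r t] rt assms by (intro mult_left_mono) (auto simp: N_def)
    ultimately show ?thesis by (simp add: field_simps)
  qed
  moreover have "continuous_on {N..} f" "N \<ge> 0" using k by (auto simp: N_def intro: continuous_on_subset)
  ultimately show ?thesis using k(1) assms by (intro exI[of _ "c * \<kappa> / 2"] conjI exI[of _ N]) auto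
qed

end

section \<open>Paths below a slowly moving boundary\<close>

locale slow_reflected_path =
  slow_boundary f f' \<gamma> + reflected_path "\<lambda>y. y powr \<gamma>" f W X L1 Lf s x
  for f f' W X L1 Lf :: "real \<Rightarrow> real" and \<gamma> s x :: real +
  assumes s_nonneg: "0 \<le> s"
begin

text \<open>
  If the path stayed below \<open>f\<close> from time \<open>a\<close> on, it would dominate its accumulated drift
  \<open>I t\<close> up to the noise. For \<open>\<gamma> < 0\<close>, since \<open>X \<le> f\<close>, this gives
  \<open>f t \<ge> I t - o (t powr p) \<ge> (t - a) * f t powr \<gamma> - o (t powr p)\<close> with \<open>p = 1 / (1 - \<gamma>)\<close>.
  Divided by \<open>t powr p\<close>, the left-hand side vanishes in the limit, but the drift term is about
  \<open>(f t / t powr p) powr \<gamma>\<close>, which is large because \<open>\<gamma> < 0\<close>. For \<open>\<gamma> \<ge> 0\<close> the drift is at least \<open>1\<close>, so \<open>I\<close> beats the noise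
  and \<open>X \<ge> I / 2\<close>; then \<open>I' = X powr \<gamma> \<ge> (I / 2) powr \<gamma>\<close>, and integrating this inequality for
  \<open>I powr (1 - \<gamma>)\<close> gives \<open>f \<ge> X \<ge> c * t powr p\<close>, again too much.
\<close>

lemma reaches_boundary:
  assumes W1: "((\<lambda>t. W t / t) \<longlongrightarrow> 0) at_top"
    and W2: "((\<lambda>t. W t / t powr (1 / (1 - \<gamma>))) \<longlongrightarrow> 0) at_top"
  shows "\<exists>r\<ge>N. X r = f r"
proof (rule ccontr)
  assume no_hit: "\<not> ?thesis"
  define p where "p = 1 / (1 - \<gamma>)"
  have p: "p > 0" "1 - p = - (p * \<gamma>)" using gamma by (auto simp: p_def field_simps)
  define a where "a = max N s + 1"
  have a: "a > 0" "s \<le> a" "N \<le> a" using s_nonneg by (auto simp: a_def)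
  have below: "X t < f t" if "t \<ge> a" for t
    using no_hit range_path[of t] that a by (force simp: order_less_le)
  define I where "I = (\<lambda>t. integral {a..t} (\<lambda>u. X u powr \<gamma>))"
  have X_ge: "X t \<ge> W t - W a + I t" if "t \<ge> a" for t
    using path_increment_ge[of a t] range_path[of a] below that a by (force simp: I_def)
  have ev_a: "\<forall>\<^sub>F t in at_top. t \<ge> 2 * a" by (rule eventually_ge_at_top)
  have p_lim: "((\<lambda>t. C / t powr p) \<longlongrightarrow> 0) at_top" for C :: real
    using p by real_asymp
  show False
  proof (cases "\<gamma> < 0")
    case True
    have lim: "((\<lambda>t. f t / t powr p - W t / t powr p + W a / t powr p) \<longlongrightarrow> 0 - 0 + 0) at_top"
      by (intro tendsto_intros p_lim W2[folded p_def] f_small[folded p_def])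
    have "\<forall>\<^sub>F t in at_top. f t / t powr p - W t / t powr p + W a / t powr p < 1 / 2"
      using order_tendstoD(2)[OF lim, of "1/2"] by simp
    moreover have "\<forall>\<^sub>F t in at_top. f t / t powr p < 1"
      using order_tendstoD(2)[OF f_small, of 1] by (simp add: p_def)
    ultimately have "\<forall>\<^sub>F t :: real in at_top. t < t"
      using ev_a
    proof eventually_elim
      case (elim t)
      have t: "t > 0" "t \<ge> a" "f t > 1" using elim(3) a f_gt_1[of t] by auto
      have "integral {a..t} (\<lambda>u. f t powr \<gamma>) \<le> I t"
        unfolding I_def
      proof (rule integral_le)
        show "(\<lambda>u. X u powr \<gamma>) integrable_on {a..t}" by (rule drift_integrable) (rule a)
        fix u assume u: "u \<in> {a..t}"
        show "f t powr \<gamma> \<le> X u powr \<gamma>"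
          using range_path[of u] u a t f_mono'[of u t] True by (intro powr_mono2') auto
      qed auto
      then have "f t \<ge> W t - W a + (t - a) * f t powr \<gamma>"
        using X_ge[of t] range_path[of t] t a by simp
      then have "(f t - W t + W a) / t powr p \<ge> (t - a) * f t powr \<gamma> / t powr p"
        by (intro divide_right_mono) auto
      moreover have "(t - a) * f t powr \<gamma> \<ge> (t / 2) * f t powr \<gamma>"
        using elim(3) by (intro mult_right_mono) auto
      then have "(t - a) * f t powr \<gamma> / t powr p \<ge> (t / 2) * f t powr \<gamma> / t powr p"
        by (intro divide_right_mono) auto
      moreover have "(t / 2) * f t powr \<gamma> / t powr p = (f t / t powr p) powr \<gamma> / 2"
      proof -
        have "t / t powr p = t powr (1 - p)" using t by (simp add: powr_diff)
        also have "\<dots> = 1 / (t powr p) powr \<gamma>"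
          unfolding p(2) by (simp add: powr_powr powr_minus divide_inverse)
        finally have "t / t powr p = 1 / (t powr p) powr \<gamma>" .
        then show ?thesis using t by (simp add: powr_divide field_simps)
      qed
      moreover have "(f t / t powr p) powr \<gamma> \<ge> 1 powr \<gamma>"
        using elim(2) t True by (intro powr_mono2') auto
      ultimately show "t < t" using elim(1) by (simp add: diff_divide_distrib add_divide_distrib)
    qed
    then show False by simp
  next
    case False
    have I_ge: "t - a \<le> I t" if "t \<ge> a" for t
    proof -
      have "integral {a..t} (\<lambda>u. 1) \<le> I t"
        unfolding I_def
      proof (rule integral_le)
        show "(\<lambda>u. X u powr \<gamma>) integrable_on {a..t}" by (rule drift_integrable) (rule a)
        fix u assume u: "u \<in> {a..t}"
        then show "1 \<le> X u powr \<gamma>"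
          using range_path[of u] a False by (auto intro!: ge_one_powr_ge_zero)
      qed auto
      then show ?thesis using that by simp
    qed
    have lim: "((\<lambda>t. W t / t - W a / t) \<longlongrightarrow> 0 - 0) at_top"
      by (intro tendsto_intros W1) real_asymp
    have "\<forall>\<^sub>F t in at_top. W t / t - W a / t > - 1 / 4"
      using order_tendstoD(1)[OF lim, of "- 1 / 4"] by simp
    then have "\<forall>\<^sub>F t in at_top. X t \<ge> I t / 2"
      using ev_a
    proof eventually_elim
      case (elim t)
      have "t > 0" using elim a by linarith
      then have "W t - W a > - t / 4" using elim(1) by (simp add: field_simps)
      then show ?case using I_ge[of t] X_ge[of t] elim(2) a by (simp add: field_simps)
    qed
    then obtain b where b: "\<And>t. t \<ge> b \<Longrightarrow> X t \<ge> I t / 2" "b \<ge> 2 * a"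
      unfolding eventually_at_top_linorder by (meson max.bounded_iff max.cobounded1)
    have growth: "I t powr (1 - \<gamma>) \<ge> (1 - \<gamma>) / 2 * (t - b)" if "t \<ge> b" for t
    proof -
      have "I b powr (1 - \<gamma>) - (1 - \<gamma>) / 2 * b \<le> I t powr (1 - \<gamma>) - (1 - \<gamma>) / 2 * t"
      proof (rule DERIV_nonneg_imp_nondecreasing[OF that])
        fix u assume u: "b \<le> u" "u \<le> t"
        have Iu: "I u > 0" using I_ge[of u] u b a by auto
        have "(I has_real_derivative X u powr \<gamma>) (at u within {a..u+1})"
          unfolding I_def using u a b
          by (intro integral_has_real_derivative continuous_drift) auto
        then have I': "(I has_real_derivative X u powr \<gamma>) (at u)"
          using at_within_Icc_at[of a u "u+1"] u a b by simp
        have d: "((\<lambda>u. I u powr (1 - \<gamma>) - (1 - \<gamma>) / 2 * u) has_real_derivative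
            (1 - \<gamma>) * I u powr (1 - \<gamma> - 1) * X u powr \<gamma> - (1 - \<gamma>) / 2) (at u)"
          using Iu by (auto intro!: derivative_eq_intros I')
        have "I u powr \<gamma> \<le> (2 * X u) powr \<gamma>"
          using b(1)[OF u(1)] Iu False by (intro powr_mono2) auto
        also have "\<dots> = 2 powr \<gamma> * X u powr \<gamma>"
          using range_path[of u] u a b by (intro powr_mult)
        also have "\<dots> \<le> 2 powr 1 * X u powr \<gamma>"
          using gamma by (intro mult_right_mono powr_mono) auto
        finally have "1 / 2 \<le> I u powr (- \<gamma>) * X u powr \<gamma>"
          using Iu by (simp add: powr_minus field_simps)
        then have "(1 - \<gamma>) * (1 / 2) \<le> (1 - \<gamma>) * (I u powr (- \<gamma>) * X u powr \<gamma>)"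
          using gamma by (intro mult_left_mono) auto
        with d show "\<exists>y. ((\<lambda>u. I u powr (1 - \<gamma>) - (1 - \<gamma>) / 2 * u) has_real_derivative y) (at u) \<and> 0 \<le> y"
          by (intro exI conjI) (auto simp: mult.assoc)
      qed
      moreover have "I b powr (1 - \<gamma>) \<ge> 0" by simp
      ultimately have "I t powr (1 - \<gamma>) \<ge> (1 - \<gamma>) / 2 * t - (1 - \<gamma>) / 2 * b" by linarith
      then show ?thesis by (simp only: right_diff_distrib)
    qed
    define c where "c = ((1 - \<gamma>) / 4) powr p / 2"
    have "c > 0" using gamma by (simp add: c_def)
    then have "\<forall>\<^sub>F t in at_top. f t / t powr p < c"
      using order_tendstoD(2)[OF f_small, of c] by (simp add: p_def)
    moreover have "\<forall>\<^sub>F t in at_top. t \<ge> 2 * b" by (rule eventually_ge_at_top)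
    ultimately have "\<forall>\<^sub>F t :: real in at_top. t < t"
    proof eventually_elim
      case (elim t)
      have t: "t \<ge> b" "t > 0" "t \<ge> a" using elim(2) a b by auto
      have "(1 - \<gamma>) / 4 * t \<le> (1 - \<gamma>) / 2 * (t - b)"
        using mult_left_mono[of "t/2" "t - b" "(1 - \<gamma>) / 2"] elim(2) gamma by simp
      also have "\<dots> \<le> I t powr (1 - \<gamma>)" by (rule growth) (rule t)
      finally have "((1 - \<gamma>) / 4 * t) powr p \<le> (I t powr (1 - \<gamma>)) powr p"
        using p t gamma by (intro powr_mono2) auto
      also have "\<dots> = I t"
        using I_ge[of t] t gamma by (simp add: powr_powr p_def)
      finally have "2 * c * t powr p \<le> I t" using t gamma by (simp add: c_def flip: powr_mult)
      also have "\<dots> \<le> 2 * X t" using b(1)[of t] t by simp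
      also have "\<dots> \<le> 2 * f t" using range_path[of t] t a by simp
      finally show "t < t" using elim(1) t by (simp add: field_simps)
    qed
    then show False by simp
  qed
qed

lemma drift_near_boundary:
  assumes "s \<le> u" "f u / 2 \<le> X u"
  shows "2 powr - \<bar>\<gamma>\<bar> * f u powr \<gamma> \<le> X u powr \<gamma>" "X u powr \<gamma> \<le> 2 powr \<bar>\<gamma>\<bar> * f u powr \<gamma>"
proof -
  have u: "0 < X u" "X u \<le> f u" "0 < f u"
    using range_path[OF assms(1)] by auto
  have eq: "(f u / 2) powr \<gamma> = 2 powr - \<gamma> * f u powr \<gamma>"
    using u by (simp add: powr_divide powr_minus_divide)
  have le: "2 powr - \<bar>\<gamma>\<bar> * f u powr \<gamma> \<le> f u powr \<gamma>" "f u powr \<gamma> \<le> 2 powr \<bar>\<gamma>\<bar> * f u powr \<gamma>"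
    using mult_right_mono[of "2 powr - \<bar>\<gamma>\<bar>" 1 "f u powr \<gamma>"]
      mult_right_mono[of 1 "2 powr \<bar>\<gamma>\<bar>" "f u powr \<gamma>"]
      powr_mono[of "- \<bar>\<gamma>\<bar>" 0 2] powr_mono[of 0 "\<bar>\<gamma>\<bar>" 2] by simp_all
  show "2 powr - \<bar>\<gamma>\<bar> * f u powr \<gamma> \<le> X u powr \<gamma>"
  proof (cases "\<gamma> \<ge> 0")
    case True
    then have "(f u / 2) powr \<gamma> \<le> X u powr \<gamma>" using u assms by (intro powr_mono2) auto
    then show ?thesis using True eq by simp
  next
    case False
    then have "f u powr \<gamma> \<le> X u powr \<gamma>" using u by (intro powr_mono2') auto
    then show ?thesis using le by simp
  qed
  show "X u powr \<gamma> \<le> 2 powr \<bar>\<gamma>\<bar> * f u powr \<gamma>"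
  proof (cases "\<gamma> \<ge> 0")
    case True
    then have "X u powr \<gamma> \<le> f u powr \<gamma>" using u by (intro powr_mono2) auto
    then show ?thesis using le by simp
  next
    case False
    then have "X u powr \<gamma> \<le> (f u / 2) powr \<gamma>" using u assms by (intro powr_mono2') auto
    then show ?thesis using False eq by simp
  qed
qed

text \<open>
  From the last visit \<open>r\<close> to \<open>f\<close> on, the drift gains \<open>\<kappa> * (t - r) * f t powr \<gamma>\<close> on the boundary,
  so only the noise can keep the path away. This needs \<open>X \<ge> f / 2\<close> since time \<open>r\<close>, which is
  automatic: at the first time with \<open>X = f / 2\<close> the estimate would already apply and give
  \<open>f / 2 \<le> z \<le> f / 4\<close>.
\<close>

lemma stays_near_boundary:
  assumes N1: "N1 \<ge> 0" "continuous_on {N1..} f"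
    and beats: "\<And>r t. r \<ge> N1 \<Longrightarrow> t \<ge> r \<Longrightarrow>
       f t - f r + \<kappa> * (t - r) * f t powr \<gamma> \<le> 2 powr - \<bar>\<gamma>\<bar> * integral {r..t} (\<lambda>u. f u powr \<gamma>)"
    and noise: "\<And>r t. r \<ge> N2 \<Longrightarrow> t \<ge> r \<Longrightarrow> W r - W t \<le> \<kappa> * (t - r) * f t powr \<gamma> + z t"
    and z_small: "\<forall>\<^sub>F t in at_top. z t \<le> f t / 4"
    and hits: "\<And>N. \<exists>r\<ge>N. X r = f r"
  shows "\<forall>\<^sub>F t in at_top. f t - X t \<le> z t"
proof -
  obtain N3 where N3: "\<And>t. t \<ge> N3 \<Longrightarrow> z t \<le> f t / 4"
    using z_small unfolding eventually_at_top_linorder by auto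
  define N where "N = max (max N1 N2) (max N3 s)"
  obtain a where a: "a \<ge> N" "X a = f a" using hits by blast
  have N: "N1 \<le> a" "N2 \<le> a" "N3 \<le> a" "s \<le> a" using a by (auto simp: N_def)
  have c_f: "continuous_on {u..v} f" and c_X: "continuous_on {u..v} X" if "u \<ge> a" for u v
    using N that by (auto intro: continuous_on_subset[OF N1(2)] continuous_on_subset[OF continuous_path])
  have "f t - X t \<le> z t" if at: "t \<ge> a" for t
  proof (rule ccontr)
    assume *: "\<not> ?thesis"
    have "z t \<ge> 0" using noise[of t t] at N by simp
    then have "f t - X t > 0" using * by simp
    then obtain r where r: "r \<in> {a..<t}" "X r = f r" "\<And>u. u \<in> {r<..t} \<Longrightarrow> X u < f u"
      using last_zero[of a t "\<lambda>u. f u - X u"] at a(2) c_f[of a t] c_X[of a t]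
      by (auto simp: continuous_on_diff)
    have key: "f v - X v \<le> z v" if v: "v \<in> {r..t}" and half: "\<And>u. u \<in> {r..v} \<Longrightarrow> f u / 2 \<le> X u" for v
    proof -
      have "integral {r..v} (\<lambda>u. 2 powr - \<bar>\<gamma>\<bar> * f u powr \<gamma>) \<le> integral {r..v} (\<lambda>u. X u powr \<gamma>)"
      proof (rule integral_le)
        show "(\<lambda>u. 2 powr - \<bar>\<gamma>\<bar> * f u powr \<gamma>) integrable_on {r..v}"
          using N r by (intro integrable_continuous_real continuous_on_mult_left
            continuous_boundary_drift[OF N1(2,1)]) auto
        show "(\<lambda>u. X u powr \<gamma>) integrable_on {r..v}" using drift_integrable N r by auto
        fix u assume "u \<in> {r..v}"
        then show "2 powr - \<bar>\<gamma>\<bar> * f u powr \<gamma> \<le> X u powr \<gamma>"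
          using half N r by (intro drift_near_boundary) auto
      qed
      then have "2 powr - \<bar>\<gamma>\<bar> * integral {r..v} (\<lambda>u. f u powr \<gamma>) \<le> integral {r..v} (\<lambda>u. X u powr \<gamma>)"
        by simp
      moreover have "X v - X r \<ge> W v - W r + integral {r..v} (\<lambda>u. X u powr \<gamma>)"
        using r v N by (intro path_increment_ge) auto
      ultimately show ?thesis
        using beats[of r v] noise[of r v] r v N by auto
    qed
    show False
    proof (cases "\<forall>u\<in>{r..t}. f u / 2 \<le> X u")
      case True
      then show False using key[of t] r * by auto
    next
      case False
      then obtain b where b: "b \<in> {r..t}" "X b < f b / 2" by auto
      have fr: "f r > 0" using f_gt_1[of r] r N N1 by auto
      \<comment> \<open>Otherwise the estimate is applied at the first time \<open>c\<close> with \<open>X c = f c / 2\<close>.\<close>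
      have "continuous_on {r..b} (\<lambda>u. X u - f u / 2)"
        using c_f[of r b] c_X[of r b] r by (auto intro!: continuous_intros)
      then obtain c where c: "c \<in> {r<..b}" "X c = f c / 2" "\<And>u. u \<in> {r..<c} \<Longrightarrow> X u > f u / 2"
        using first_zero[of r b "\<lambda>u. X u - f u / 2"] b r fr by auto
      have "f u / 2 \<le> X u" if "u \<in> {r..c}" for u
        using c(2) c(3)[of u] that by (cases "u = c") auto
      then have "f c - X c \<le> z c" using key[of c] b c by auto
      moreover have "f c > 0" using f_gt_1[of c] c r N N1 by auto
      moreover have "z c \<le> f c / 4" using N3 c r N by auto
      ultimately show False using c(2) by simp
    qed
  qed
  then show ?thesis unfolding eventually_at_top_linorder by blast
qed

end

section \<open>Brownian oscillation and growth\<close>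

lemma (in prob_space) borel_cantelli_le:
  assumes A: "\<And>n. A n \<in> events" and le: "\<forall>\<^sub>F n in sequentially. prob (A n) \<le> c n"
    and c: "summable c"
  shows "AE \<omega> in M. \<forall>\<^sub>F n in sequentially. \<omega> \<notin> A n"
proof -
  have "summable (\<lambda>n. prob (A n))"
    by (rule summable_comparison_test_ev[OF _ c]) (use le in \<open>auto elim: eventually_mono\<close>)
  then have "AE \<omega> in M. \<forall>\<^sub>F n in sequentially. \<omega> \<in> space M - A n"
    by (intro borel_cantelli_AE1 A) (auto simp: emeasure_eq_measure)
  then show ?thesis by (rule AE_mp) (auto elim: eventually_mono)
qed

text \<open>
  An odd multiple of \<open>1 / 2 ^ Suc m\<close> is one step of level \<open>Suc m\<close> away from a multiple of
  \<open>1 / 2 ^ m\<close>; descending through the levels uses at most one step of each.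
\<close>

lemma dyadic_chain:
  fixes g :: "real \<Rightarrow> real"
  assumes step: "\<And>m i. i < 2 ^ m \<Longrightarrow> \<bar>g (real (Suc i) / 2 ^ m) - g (real i / 2 ^ m)\<bar> \<le> d m"
  shows "i \<le> 2 ^ m \<Longrightarrow> \<bar>g (real i / 2 ^ m) - g 0\<bar> \<le> (\<Sum>k\<le>m. d k)"
proof (induction m arbitrary: i)
  case 0
  then have "i = 0 \<or> i = 1" by auto
  then show ?case using step[of 0 0] by auto
next
  case (Suc m)
  have d: "0 \<le> d (Suc m)" using step[of 0 "Suc m"] by simp
  define k where "k = i div 2"
  have k: "k \<le> 2 ^ m" using Suc.prems by (auto simp: k_def)
  have eq: "real (2 * k) / 2 ^ Suc m = real k / 2 ^ m" by simp
  have IH: "\<bar>g (real (2 * k) / 2 ^ Suc m) - g 0\<bar> \<le> (\<Sum>k\<le>m. d k)"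
    using Suc.IH[OF k] unfolding eq .
  show ?case
  proof (cases "even i")
    case True
    then have "i = 2 * k" by (simp add: k_def)
    then show ?thesis using IH d by simp
  next
    case False
    then have i: "i = Suc (2 * k)" by (simp add: k_def)
    then have "2 * k < 2 ^ Suc m" using Suc.prems by simp
    from step[OF this] IH show ?thesis unfolding i sum.atMost_Suc by linarith
  qed
qed

lemma chaining_bound:
  fixes g :: "real \<Rightarrow> real"
  assumes cont: "continuous_on {0..1} g" and d: "summable d"
    and step: "\<And>m i. i < 2 ^ m \<Longrightarrow> \<bar>g (real (Suc i) / 2 ^ m) - g (real i / 2 ^ m)\<bar> \<le> d m"
    and u: "u \<in> {0..1}"
  shows "\<bar>g u - g 0\<bar> \<le> suminf d"
proof -
  have d0: "0 \<le> d m" for m using step[of 0 m] by simp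
  define i where "i m = nat \<lfloor>u * 2 ^ m\<rfloor>" for m :: nat
  have i_eq: "real (i m) = real_of_int \<lfloor>u * 2 ^ m\<rfloor>" for m using u by (simp add: i_def)
  have i_bounds: "u * 2 ^ m - 1 \<le> real (i m)" "real (i m) \<le> u * 2 ^ m" for m
    unfolding i_eq by linarith+
  have i_le: "i m \<le> 2 ^ m" for m
  proof -
    have "real (i m) \<le> 1 * 2 ^ m"
      by (rule order_trans[OF i_bounds(2)]) (use u in \<open>intro mult_right_mono, auto\<close>)
    then show ?thesis by (metis mult_1 of_nat_le_iff of_nat_numeral of_nat_power)
  qed
  have lim: "(\<lambda>m. real (i m) / 2 ^ m) \<longlonglongrightarrow> u"
  proof (rule tendsto_sandwich)
    show "\<forall>\<^sub>F m in sequentially. u - (1/2) ^ m \<le> real (i m) / 2 ^ m"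
    proof (rule always_eventually, rule allI)
      fix m show "u - (1/2) ^ m \<le> real (i m) / 2 ^ m"
        using divide_right_mono[OF i_bounds(1)[of m], of "2 ^ m"]
        by (simp add: diff_divide_distrib power_divide)
    qed
    show "\<forall>\<^sub>F m in sequentially. real (i m) / 2 ^ m \<le> u"
      using i_bounds(2) by (auto simp: field_simps)
    have "(\<lambda>m. u - (1/2) ^ m) \<longlonglongrightarrow> u - 0"
      by (intro tendsto_intros LIMSEQ_power_zero) auto
    then show "(\<lambda>m. u - (1/2) ^ m) \<longlonglongrightarrow> u" by simp
  qed simp
  have "real (i m) / 2 ^ m \<in> {0..1}" for m
  proof -
    have "real (i m) \<le> real (2 ^ m)" using i_le by (simp only: of_nat_le_iff)
    then show ?thesis by simp
  qed
  then have "(\<lambda>m. g (real (i m) / 2 ^ m)) \<longlonglongrightarrow> g u"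
    by (intro continuous_on_tendsto_compose[OF cont lim u] always_eventually allI)
  then have "(\<lambda>m. \<bar>g (real (i m) / 2 ^ m) - g 0\<bar>) \<longlonglongrightarrow> \<bar>g u - g 0\<bar>"
    by (intro tendsto_intros)
  moreover have "\<bar>g (real (i m) / 2 ^ m) - g 0\<bar> \<le> suminf d" for m
  proof (rule order_trans)
    show "\<bar>g (real (i m) / 2 ^ m) - g 0\<bar> \<le> (\<Sum>k\<le>m. d k)"
      by (rule dyadic_chain[OF step i_le])
    show "(\<Sum>k\<le>m. d k) \<le> suminf d" by (intro sum_le_suminf d) (auto simp: d0)
  qed
  ultimately show ?thesis by (intro LIMSEQ_le_const2) auto
qed

context brownian_motion
begin

lemma random_variable_increment [measurable]:
  "0 \<le> u \<Longrightarrow> 0 \<le> t \<Longrightarrow> (\<lambda>\<omega>. W t \<omega> - W u \<omega>) \<in> borel_measurable M"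
  using random_variable_W by (intro borel_measurable_diff) auto

text \<open>
  Where \<open>b\<^sup>2 \<le> b * y\<close>, the centred Gaussian density at \<open>y\<close> is at most \<open>exp (- b\<^sup>2 / (2 * \<sigma>\<^sup>2))\<close>
  times the density with mean \<open>b\<close>, whose total mass is \<open>1\<close>. The product form of the event covers
  the upper tail (\<open>b > 0\<close>) and the lower tail (\<open>b < 0\<close>) at once.
\<close>

lemma increment_tail:
  assumes "0 \<le> u" "u < t"
  shows "prob {\<omega> \<in> space M. b\<^sup>2 \<le> b * (W t \<omega> - W u \<omega>)} \<le> exp (- b\<^sup>2 / (2 * (t - u)))"
proof -
  define \<sigma> where "\<sigma> = sqrt (t - u)"
  have \<sigma>: "\<sigma> > 0" "\<sigma>\<^sup>2 = t - u" using assms by (auto simp: \<sigma>_def)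
  define A where "A = {y. b\<^sup>2 \<le> b * y}"
  have A: "A \<in> sets borel" unfolding A_def by measurable
  define e where "e = exp (- b\<^sup>2 / (2 * (t - u)))"
  have "emeasure M ((\<lambda>\<omega>. W t \<omega> - W u \<omega>) -` A \<inter> space M)
      = (\<integral>\<^sup>+y. ennreal (normal_density 0 \<sigma> y) * indicator A y \<partial>lborel)"
    using distributed_emeasure[OF normal_increments[OF assms], of A] A by (simp add: \<sigma>_def)
  also have "\<dots> \<le> (\<integral>\<^sup>+y. ennreal e * ennreal (normal_density b \<sigma> y) \<partial>lborel)"
  proof (rule nn_integral_mono)
    fix y
    have "normal_density 0 \<sigma> y \<le> e * normal_density b \<sigma> y" if "y \<in> A"
    proof -
      have "- y\<^sup>2 / (2 * \<sigma>\<^sup>2) \<le> - b\<^sup>2 / (2 * \<sigma>\<^sup>2) + - (y - b)\<^sup>2 / (2 * \<sigma>\<^sup>2)"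
        using that \<sigma>(1) unfolding add_divide_distrib[symmetric]
        by (intro divide_right_mono) (auto simp: A_def power2_eq_square algebra_simps)
      then have "exp (- y\<^sup>2 / (2 * \<sigma>\<^sup>2)) \<le> e * exp (- (y - b)\<^sup>2 / (2 * \<sigma>\<^sup>2))"
        unfolding e_def \<sigma>(2)[symmetric] exp_add[symmetric] by simp
      from mult_left_mono[OF this, of "1 / sqrt (2 * pi * \<sigma>\<^sup>2)"] show ?thesis
        by (simp add: normal_density_def mult_ac)
    qed
    then show "ennreal (normal_density 0 \<sigma> y) * indicator A y \<le> ennreal e * ennreal (normal_density b \<sigma> y)"
      by (auto simp: indicator_def e_def ennreal_mult'[symmetric] intro: ennreal_leI)
  qed
  also have "\<dots> = ennreal e * (\<integral>\<^sup>+y. ennreal (normal_density b \<sigma> y) \<partial>lborel)"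
    by (rule nn_integral_cmult) simp
  also have "(\<integral>\<^sup>+y. ennreal (normal_density b \<sigma> y) \<partial>lborel) = 1"
    using prob_space.emeasure_space_1[OF prob_space_normal_density[OF \<sigma>(1), of b]]
    by (simp add: emeasure_density)
  finally have "prob ((\<lambda>\<omega>. W t \<omega> - W u \<omega>) -` A \<inter> space M) \<le> e"
    by (simp add: emeasure_eq_measure e_def)
  also have "(\<lambda>\<omega>. W t \<omega> - W u \<omega>) -` A \<inter> space M = {\<omega> \<in> space M. b\<^sup>2 \<le> b * (W t \<omega> - W u \<omega>)}"
    by (auto simp: A_def)
  finally show ?thesis by (simp add: e_def)
qed

lemma increment_tail_abs:
  assumes "0 \<le> u" "u < t" "a > 0"
  shows "prob {\<omega> \<in> space M. a \<le> \<bar>W t \<omega> - W u \<omega>\<bar>} \<le> 2 * exp (- a\<^sup>2 / (2 * (t - u)))"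
proof -
  have [measurable]: "(\<lambda>\<omega>. W t \<omega> - W u \<omega>) \<in> borel_measurable M"
    using assms by (intro random_variable_increment) auto
  have cancel: "a\<^sup>2 \<le> a * y \<longleftrightarrow> a \<le> y" "(-a)\<^sup>2 \<le> (-a) * y \<longleftrightarrow> a \<le> - y" for y
    using mult_le_cancel_left_pos[OF assms(3), of a y] mult_le_cancel_left_pos[OF assms(3), of a "- y"]
    by (simp_all add: power2_eq_square)
  define S where "S b = {\<omega> \<in> space M. b\<^sup>2 \<le> b * (W t \<omega> - W u \<omega>)}" for b
  have S: "S b \<in> events" for b unfolding S_def by measurable
  have "{\<omega> \<in> space M. a \<le> \<bar>W t \<omega> - W u \<omega>\<bar>} = S a \<union> S (- a)"
    unfolding S_def cancel by auto
  then have "prob {\<omega> \<in> space M. a \<le> \<bar>W t \<omega> - W u \<omega>\<bar>} \<le> prob (S a) + prob (S (- a))"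
    using measure_Un_le[OF S S] by simp
  moreover have "prob (S b) \<le> exp (- b\<^sup>2 / (2 * (t - u)))" for b
    unfolding S_def by (rule increment_tail[OF assms(1,2)])
  from add_mono[OF this[of a] this[of "- a"]]
  have "prob (S a) + prob (S (- a)) \<le> 2 * exp (- a\<^sup>2 / (2 * (t - u)))"
    by (simp only: power2_minus mult_2)
  ultimately show ?thesis by (rule order_trans)
qed

text \<open>
  The dyadic increments of level \<open>m\<close> are compared with thresholds \<open>d j m\<close> of order
  \<open>m * 2 powr (- m / 2) * sqrt (ln j)\<close>. These are summable in \<open>m\<close> with sum a constant times
  \<open>sqrt (ln j)\<close>, yet the factor \<open>m\<close> makes the Gaussian tails win over the number \<open>2 ^ m\<close> of
  increments. Chaining needs no independence, hence no maximal inequality. The order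
  \<open>sqrt (ln j)\<close>, rather than \<open>ln j\<close>, matters: the boundary \<open>(ln t) powr l\<close>, which must dominate
  it, may have an exponent \<open>l\<close> close to \<open>1 / 2\<close> when \<open>\<gamma>\<close> is close to \<open>1\<close>.
\<close>

lemma unit_oscillation:
  "\<exists>K\<ge>0. AE \<omega> in M. \<forall>\<^sub>F j :: nat in sequentially.
     \<forall>u\<in>{real j..real j + 1}. \<bar>W u \<omega> - W (real j) \<omega>\<bar> \<le> K * sqrt (ln (real j + 2))"
proof -
  define q :: real where "q = sqrt (1 / 2)"
  have q: "0 < q" "q < 1" "q\<^sup>2 = 1 / 2" by (auto simp: q_def)
  define d where "d j m = 2 * sqrt (ln (real j + 2)) * (real (Suc m) * q ^ m)" for j m
  have sum_q: "(\<lambda>m. real (Suc m) * q ^ m) sums (1 / (1 - q)\<^sup>2)"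
    using geometric_deriv_sums[of q] q by simp
  have "d j = (\<lambda>m. 2 * sqrt (ln (real j + 2)) * (real (Suc m) * q ^ m))" for j
    by (rule ext) (simp only: d_def)
  then have "d j sums (2 * sqrt (ln (real j + 2)) * (1 / (1 - q)\<^sup>2))" for j
    using sums_mult[OF sum_q] by simp
  then have d: "summable (d j)" "suminf (d j) = 2 / (1 - q)\<^sup>2 * sqrt (ln (real j + 2))" for j
    by (auto simp: sums_iff)
  define t where "t j m i = real j + real i / 2 ^ m" for j m i :: nat
  define A where "A j m = (\<Union>i<2^m. {\<omega> \<in> space M. d j m \<le> \<bar>W (t j m (Suc i)) \<omega> - W (t j m i) \<omega>\<bar>})" for j m
  have t: "0 \<le> t j m i" "t j m i < t j m (Suc i)" "t j m (Suc i) - t j m i = 1 / 2 ^ m" for j m i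
    by (auto simp: t_def field_simps)
  have A_event: "{\<omega> \<in> space M. d j m \<le> \<bar>W (t j m (Suc i)) \<omega> - W (t j m i) \<omega>\<bar>} \<in> events" for j m i
  proof -
    have [measurable]: "(\<lambda>\<omega>. W (t j m (Suc i)) \<omega> - W (t j m i) \<omega>) \<in> borel_measurable M"
      by (intro random_variable_increment t)
    show ?thesis by measurable
  qed
  then have A: "A j m \<in> events" for j m unfolding A_def by (intro sets.finite_UN) auto
  have prob_A: "prob (A j m) \<le> 2 / (real j + 2)\<^sup>2 * (1 / 8) ^ m" for j m
  proof -
    have dj: "d j m > 0" using q by (auto simp: d_def)
    have "(d j m)\<^sup>2 = 4 * ln (real j + 2) * (real (Suc m))\<^sup>2 * (q\<^sup>2) ^ m"
      by (simp add: d_def power_mult_distrib power_mult[symmetric] mult.commute)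
    then have d2: "(d j m)\<^sup>2 / (2 * (1 / 2 ^ m)) = 2 * (real (Suc m))\<^sup>2 * ln (real j + 2)"
      unfolding q by (simp add: power_divide)
    have "exp (- (d j m)\<^sup>2 / (2 * (1 / 2 ^ m))) = exp (- (2 * (real (Suc m))\<^sup>2 * ln (real j + 2)))"
      using d2 by simp
    also have "\<dots> \<le> exp (- (real (2 + 4 * m) * ln (real j + 2)))"
    proof -
      have "real (2 + 4 * m) \<le> 2 * (real (Suc m))\<^sup>2" by (simp add: power2_eq_square algebra_simps)
      then have "real (2 + 4 * m) * ln (real j + 2) \<le> 2 * (real (Suc m))\<^sup>2 * ln (real j + 2)"
        by (rule mult_right_mono) simp
      then show ?thesis by simp
    qed
    also have "\<dots> = 1 / (real j + 2) ^ (2 + 4 * m)"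
      by (subst exp_minus, subst exp_of_nat_mult, subst exp_ln) (auto simp: divide_inverse)
    also have "\<dots> \<le> 1 / ((real j + 2)\<^sup>2 * 16 ^ m)"
    proof (intro divide_left_mono)
      have "(2 :: real) ^ (4 * m) \<le> (real j + 2) ^ (4 * m)" by (intro power_mono) auto
      then have "(16 :: real) ^ m \<le> (real j + 2) ^ (4 * m)" by (simp add: power_mult)
      then show "(real j + 2)\<^sup>2 * 16 ^ m \<le> (real j + 2) ^ (2 + 4 * m)"
        unfolding power_add by (intro mult_left_mono) auto
    qed auto
    finally have tail: "exp (- (d j m)\<^sup>2 / (2 * (1 / 2 ^ m))) \<le> 1 / ((real j + 2)\<^sup>2 * 16 ^ m)" .
    have "prob (A j m) \<le> (\<Sum>i<2^m. prob {\<omega> \<in> space M. d j m \<le> \<bar>W (t j m (Suc i)) \<omega> - W (t j m i) \<omega>\<bar>})"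
      unfolding A_def by (intro finite_measure_subadditive_finite) (use A_event in auto)
    also have "\<dots> \<le> (\<Sum>i<(2::nat)^m. 2 * (1 / ((real j + 2)\<^sup>2 * 16 ^ m)))"
    proof (rule sum_mono)
      fix i
      show "prob {\<omega> \<in> space M. d j m \<le> \<bar>W (t j m (Suc i)) \<omega> - W (t j m i) \<omega>\<bar>}
          \<le> 2 * (1 / ((real j + 2)\<^sup>2 * 16 ^ m))"
        using increment_tail_abs[OF t(1,2)[of j m i] dj] tail unfolding t(3) by linarith
    qed
    also have "\<dots> = 2 / (real j + 2)\<^sup>2 * (2 ^ m / 16 ^ m)" by simp
    also have "(2 :: real) ^ m / 16 ^ m = (1 / 8) ^ m" by (simp add: power_divide[symmetric])
    finally show ?thesis .
  qed
  have "AE \<omega> in M. \<forall>\<^sub>F j in sequentially. \<omega> \<notin> (\<Union>m. A j m)"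
  proof (rule borel_cantelli_le)
    show "(\<Union>m. A j m) \<in> events" for j using A by auto
    have "prob (\<Union>m. A j m) \<le> 16 / 7 * (1 / (real j + 2)\<^sup>2)" for j
    proof -
      have s: "(\<lambda>m. 2 / (real j + 2)\<^sup>2 * (1 / 8) ^ m) sums (2 / (real j + 2)\<^sup>2 * (1 / (1 - 1 / 8)))"
        by (intro sums_mult geometric_sums) auto
      have sm: "summable (\<lambda>m. prob (A j m))"
        by (rule summable_comparison_test'[OF sums_summable[OF s], of 0]) (use prob_A in auto)
      have "prob (\<Union>m. A j m) \<le> (\<Sum>m. prob (A j m))"
        by (intro finite_measure_subadditive_countably sm) (use A in auto)
      also have "\<dots> \<le> (\<Sum>m. 2 / (real j + 2)\<^sup>2 * (1 / 8) ^ m)"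
        by (intro suminf_le prob_A sm sums_summable[OF s])
      also have "\<dots> = 16 / 7 * (1 / (real j + 2)\<^sup>2)" using sums_unique[OF s] by simp
      finally show ?thesis .
    qed
    then show "\<forall>\<^sub>F j in sequentially. prob (\<Union>m. A j m) \<le> 16 / 7 * (1 / (real j + 2)\<^sup>2)" by simp
    have "summable (\<lambda>j. 1 / (real (j + 2))\<^sup>2)"
      using inverse_power_summable[of 2, where 'a = real] 
      by (subst summable_iff_shift[of "\<lambda>j. 1 / (real j)\<^sup>2"]) (simp add: divide_inverse)
    then show "summable (\<lambda>j. 16 / 7 * (1 / (real j + 2)\<^sup>2))"
      by (intro summable_mult) (simp add: add.commute)
  qed
  then have "AE \<omega> in M. \<forall>\<^sub>F j :: nat in sequentially.
     \<forall>u\<in>{real j..real j + 1}. \<bar>W u \<omega> - W (real j) \<omega>\<bar> \<le> 2 / (1 - q)\<^sup>2 * sqrt (ln (real j + 2))"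
    using continuous_W AE_space
  proof eventually_elim
    case (elim \<omega>)
    from elim(1) show ?case
    proof eventually_elim
      case (elim j)
      show ?case
      proof
        fix u assume u: "u \<in> {real j..real j + 1}"
        have "\<bar>W (real j + (u - real j)) \<omega> - W (real j + 0) \<omega>\<bar> \<le> suminf (d j)"
        proof (rule chaining_bound[where g = "\<lambda>v. W (real j + v) \<omega>"])
          show "continuous_on {0..1} (\<lambda>v. W (real j + v) \<omega>)"
            by (rule continuous_on_compose2[OF \<open>continuous_on {0..} (\<lambda>t. W t \<omega>)\<close>])
               (auto intro!: continuous_intros)
          show "\<bar>W (real j + real (Suc i) / 2 ^ m) \<omega> - W (real j + real i / 2 ^ m) \<omega>\<bar> \<le> d j m"
            if "i < 2 ^ m" for m i
          proof -
            have "\<omega> \<notin> {\<omega> \<in> space M. d j m \<le> \<bar>W (t j m (Suc i)) \<omega> - W (t j m i) \<omega>\<bar>}"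
              using elim that unfolding A_def by blast
            then have "\<bar>W (t j m (Suc i)) \<omega> - W (t j m i) \<omega>\<bar> < d j m"
              using \<open>\<omega> \<in> space M\<close> by simp
            then show ?thesis unfolding t_def by (rule less_imp_le)
          qed
        qed (use u d in auto)
        then show "\<bar>W u \<omega> - W (real j) \<omega>\<bar> \<le> 2 / (1 - q)\<^sup>2 * sqrt (ln (real j + 2))"
          using d(2)[of j] by simp
      qed
    qed
  qed
  then show ?thesis by (intro exI[of _ "2 / (1 - q)\<^sup>2"]) auto
qed

lemma integer_growth:
  "AE \<omega> in M. \<forall>\<^sub>F n :: nat in sequentially. \<bar>W (real n) \<omega> - W 0 \<omega>\<bar> \<le> sqrt (6 * real n * ln (real n))"
proof -
  define A where "A n = {\<omega> \<in> space M. sqrt (6 * real n * ln (real n)) \<le> \<bar>W (real n) \<omega> - W 0 \<omega>\<bar>}" for n :: nat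
  have "AE \<omega> in M. \<forall>\<^sub>F n in sequentially. \<omega> \<notin> A n"
  proof (rule borel_cantelli_le)
    show "A n \<in> events" for n
    proof -
      have [measurable]: "(\<lambda>\<omega>. W (real n) \<omega> - W 0 \<omega>) \<in> borel_measurable M"
        by (intro random_variable_increment) auto
      show ?thesis unfolding A_def by measurable
    qed
    show "\<forall>\<^sub>F n in sequentially. prob (A n) \<le> 2 * inverse (real n ^ 3)"
      using eventually_ge_at_top[of 2]
    proof eventually_elim
      case (elim n)
      have "0 < sqrt (6 * real n * ln (real n))" using elim by auto
      from increment_tail_abs[OF order_refl _ this, of "real n"] elim
      have "prob (A n) \<le> 2 * exp (- (6 * real n * ln (real n)) / (2 * real n))"
        by (simp add: A_def)
      also have "- (6 * real n * ln (real n)) / (2 * real n) = - (real 3 * ln (real n))"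
        using elim by (simp add: field_simps)
      also have "exp \<dots> = inverse (real n ^ 3)"
        by (subst exp_minus, subst exp_of_nat_mult, subst exp_ln) (use elim in auto)
      finally show ?case .
    qed
    show "summable (\<lambda>n. 2 * inverse (real n ^ 3))"
      by (intro summable_mult inverse_power_summable) auto
  qed
  then show ?thesis
    using AE_space
  proof eventually_elim
    case (elim \<omega>)
    from elim(1) show ?case by eventually_elim (use elim(2) in \<open>auto simp: A_def\<close>)
  qed
qed

lemma growth_less_than_power:
  assumes "p > 1 / 2"
  shows "AE \<omega> in M. ((\<lambda>t. W t \<omega> / t powr p) \<longlongrightarrow> 0) at_top"
proof -
  obtain K where K: "K \<ge> 0" "AE \<omega> in M. \<forall>\<^sub>F j :: nat in sequentially.
     \<forall>u\<in>{real j..real j + 1}. \<bar>W u \<omega> - W (real j) \<omega>\<bar> \<le> K * sqrt (ln (real j + 2))"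
    using unit_oscillation by blast
  from K(2) integer_growth show ?thesis
  proof eventually_elim
    case (elim \<omega>)
    define b where "b t = sqrt (6 * t * ln t) + K * sqrt (ln (t + 2)) + \<bar>W 0 \<omega>\<bar>" for t :: real
    obtain N where N':
      "\<And>n. n \<ge> N \<Longrightarrow> (\<forall>u\<in>{real n..real n + 1}. \<bar>W u \<omega> - W (real n) \<omega>\<bar> \<le> K * sqrt (ln (real n + 2))) \<and>
        \<bar>W (real n) \<omega> - W 0 \<omega>\<bar> \<le> sqrt (6 * real n * ln (real n))"
      using eventually_conj[OF elim] unfolding eventually_sequentially by blast
    then have N: "\<And>n u. n \<ge> N \<Longrightarrow> u \<in> {real n..real n + 1} \<Longrightarrow> \<bar>W u \<omega> - W (real n) \<omega>\<bar> \<le> K * sqrt (ln (real n + 2))"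
      "\<And>n. n \<ge> N \<Longrightarrow> \<bar>W (real n) \<omega> - W 0 \<omega>\<bar> \<le> sqrt (6 * real n * ln (real n))"
      by blast+
    have "\<forall>\<^sub>F t in at_top. norm (W t \<omega> / t powr p) \<le> b t / t powr p"
      using eventually_ge_at_top[of "real N + 1"]
    proof eventually_elim
      case (elim t)
      define n where "n = nat \<lfloor>t\<rfloor>"
      have n: "n \<ge> N" "t \<in> {real n..real n + 1}" "real n \<ge> 1" using elim by (auto simp: n_def) linarith+
      have "\<bar>W t \<omega>\<bar> \<le> sqrt (6 * real n * ln (real n)) + K * sqrt (ln (real n + 2)) + \<bar>W 0 \<omega>\<bar>"
        using N(1)[OF n(1,2)] N(2)[OF n(1)] by linarith
      also have "\<dots> \<le> b t"
        unfolding b_def using n K(1)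
        by (intro add_mono mult_left_mono real_sqrt_le_mono mult_mono) auto
      finally show ?case by (simp add: divide_right_mono)
    qed
    moreover have "((\<lambda>t. b t / t powr p) \<longlongrightarrow> 0) at_top"
      unfolding b_def using assms by real_asymp
    ultimately show ?case by (rule Lim_null_comparison)
  qed
qed

section \<open>Brownian drawdowns and drops\<close>

text \<open>
  Over \<open>m = n - k\<close> time units the event has Gaussian exponent \<open>(\<beta> * m + z)\<^sup>2 / (2 * m)\<close>, which by
  the arithmetic-geometric mean inequality is at least \<open>2 * \<beta> * z\<close>, uniformly in \<open>k\<close>. The
  condition \<open>2 * ln n \<le> \<beta> n * z n\<close> makes each probability at most \<open>n powr - 3\<close>, which survives
  both the union over \<open>k\<close> and the summation over \<open>n\<close>.
\<close>

lemma drawdown_integers: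
  fixes z \<beta> :: "nat \<Rightarrow> real"
  assumes pos: "\<And>n. 0 < z n" "\<And>n. 0 \<le> \<beta> n"
    and large: "\<forall>\<^sub>F n in sequentially. 2 * ln (real n) \<le> \<beta> n * z n"
  shows "AE \<omega> in M. \<forall>\<^sub>F n in sequentially. \<forall>k\<le>n. W (real k) \<omega> - W (real n) \<omega> \<le> \<beta> n * real (n - k) + z n"
proof -
  define b where "b n k = \<beta> n * real (n - k) + z n" for n k
  define E where "E n k = {\<omega> \<in> space M. (- b n k)\<^sup>2 \<le> (- b n k) * (W (real n) \<omega> - W (real k) \<omega>)}" for n k
  have E: "E n k \<in> events" for n k
  proof -
    have [measurable]: "(\<lambda>\<omega>. W (real n) \<omega> - W (real k) \<omega>) \<in> borel_measurable M"
      by (intro random_variable_increment) auto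
    show ?thesis unfolding E_def by measurable
  qed
  have b: "b n k > 0" for n k unfolding b_def using pos[of n] by (intro add_nonneg_pos mult_nonneg_nonneg) auto
  have "AE \<omega> in M. \<forall>\<^sub>F n in sequentially. \<omega> \<notin> (\<Union>k<n. E n k)"
  proof (rule borel_cantelli_le)
    show "(\<Union>k<n. E n k) \<in> events" for n using E by auto
    show "\<forall>\<^sub>F n in sequentially. prob (\<Union>k<n. E n k) \<le> inverse (real n ^ 2)"
      using large eventually_ge_at_top[of 1]
    proof eventually_elim
      case (elim n)
      have "prob (E n k) \<le> inverse (real n ^ 3)" if k: "k < n" for k
      proof -
        define m where "m = real (n - k)"
        have m: "m > 0" "real n - real k = m" using k by (auto simp: m_def)
        have "prob (E n k) \<le> exp (- (b n k)\<^sup>2 / (2 * m))"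
          using increment_tail[of "real k" "real n" "- b n k"] k m by (simp add: E_def)
        also have "\<dots> \<le> exp (- (real 3 * ln (real n)))"
        proof -
          have "0 \<le> (\<beta> n * m - z n)\<^sup>2" by simp
          then have "4 * (\<beta> n * z n) * m \<le> (b n k)\<^sup>2"
            by (simp add: b_def m_def power2_eq_square algebra_simps)
          moreover have "8 * ln (real n) * m \<le> 4 * (\<beta> n * z n) * m"
            using elim m by (intro mult_right_mono) auto
          moreover have "6 * ln (real n) * m \<le> 8 * ln (real n) * m"
            using elim m by (intro mult_right_mono) auto
          ultimately have "3 * ln (real n) * (2 * m) \<le> (b n k)\<^sup>2" by linarith
          then have "3 * ln (real n) \<le> (b n k)\<^sup>2 / (2 * m)" using m by (simp add: pos_le_divide_eq)
          then show ?thesis by simp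
        qed
        also have "\<dots> = inverse (real n ^ 3)"
          by (subst exp_minus, subst exp_of_nat_mult, subst exp_ln) (use elim in auto)
        finally show ?thesis .
      qed
      then have "(\<Sum>k<n. prob (E n k)) \<le> (\<Sum>k<n. inverse (real n ^ 3))" by (intro sum_mono) auto
      also have "\<dots> = inverse (real n ^ 2)"
        using elim by (simp add: power2_eq_square power3_eq_cube field_simps)
      finally have "(\<Sum>k<n. prob (E n k)) \<le> inverse (real n ^ 2)" .
      moreover have "prob (\<Union>k<n. E n k) \<le> (\<Sum>k<n. prob (E n k))"
        by (intro finite_measure_subadditive_finite) (use E in auto)
      ultimately show ?case by simp
    qed
    show "summable (\<lambda>n. inverse (real n ^ 2))" by (rule inverse_power_summable) simp
  qed
  then show ?thesis
    using AE_space
  proof eventually_elim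
    case (elim \<omega>)
    from elim(1) show ?case
    proof eventually_elim
      case (elim n)
      show ?case
      proof (intro allI impI)
        fix k assume k: "k \<le> n"
        show "W (real k) \<omega> - W (real n) \<omega> \<le> \<beta> n * real (n - k) + z n"
        proof (cases "k = n")
          case True
          then show ?thesis using pos(1)[of n] by simp
        next
          case False
          then have "\<omega> \<notin> E n k" using elim k by auto
          then have "b n k * (W (real k) \<omega> - W (real n) \<omega>) < b n k * b n k"
            using \<open>\<omega> \<in> space M\<close> by (simp add: E_def power2_eq_square algebra_simps)
          then show ?thesis using b[of n k] by (simp add: b_def)
        qed
      qed
    qed
  qed
qed

text \<open>
  Passing to real times costs at most three oscillations over unit intervals, absorbed by the
  second \<open>z\<close>.
\<close>

lemma drawdown:
  fixes z \<beta> :: "nat \<Rightarrow> real"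
  assumes pos: "\<And>n. 0 < z n" "\<And>n. 0 \<le> \<beta> n"
    and large: "\<forall>\<^sub>F n in sequentially. 2 * ln (real n) \<le> \<beta> n * z n"
    and z: "\<And>C. \<forall>\<^sub>F n in sequentially. C * sqrt (ln (real n + 2)) \<le> z n"
  shows "AE \<omega> in M. \<exists>N. \<forall>r\<ge>N. \<forall>t\<ge>r. W r \<omega> - W t \<omega> \<le> \<beta> (nat \<lfloor>t\<rfloor>) * (t - r) + 2 * z (nat \<lfloor>t\<rfloor>)"
proof -
  obtain K where K: "K \<ge> 0" "AE \<omega> in M. \<forall>\<^sub>F j :: nat in sequentially.
     \<forall>u\<in>{real j..real j + 1}. \<bar>W u \<omega> - W (real j) \<omega>\<bar> \<le> K * sqrt (ln (real j + 2))"
    using unit_oscillation by blast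
  from K(2) drawdown_integers[OF pos large] show ?thesis
  proof eventually_elim
    case (elim \<omega>)
    define osc where "osc n = K * sqrt (ln (real n + 2))" for n :: nat
    have "\<forall>\<^sub>F n in sequentially.
        (\<forall>u\<in>{real n..real n + 1}. \<bar>W u \<omega> - W (real n) \<omega>\<bar> \<le> osc n) \<and>
        (\<forall>k\<le>n. W (real k) \<omega> - W (real n) \<omega> \<le> \<beta> n * real (n - k) + z n) \<and> 3 * osc n \<le> z n"
      using elim z[of "3 * K"] unfolding osc_def mult.assoc by eventually_elim auto
    then obtain N where N':
      "\<And>n. n \<ge> N \<Longrightarrow> (\<forall>u\<in>{real n..real n + 1}. \<bar>W u \<omega> - W (real n) \<omega>\<bar> \<le> osc n) \<and>
        (\<forall>k\<le>n. W (real k) \<omega> - W (real n) \<omega> \<le> \<beta> n * real (n - k) + z n) \<and> 3 * osc n \<le> z n"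
      unfolding eventually_sequentially by blast
    then have N: "\<And>n u. n \<ge> N \<Longrightarrow> u \<in> {real n..real n + 1} \<Longrightarrow> \<bar>W u \<omega> - W (real n) \<omega>\<bar> \<le> osc n"
      "\<And>n k. n \<ge> N \<Longrightarrow> k \<le> n \<Longrightarrow> W (real k) \<omega> - W (real n) \<omega> \<le> \<beta> n * real (n - k) + z n"
      "\<And>n. n \<ge> N \<Longrightarrow> 3 * osc n \<le> z n"
      by blast+
    have o_mono: "osc j \<le> osc n" if "j \<le> n" for j n
      unfolding osc_def using that K(1) by (intro mult_left_mono) auto
    show ?case
    proof (intro exI[of _ "real N"] allI impI)
      fix r t assume r: "real N \<le> r" and t: "r \<le> t"
      define j where "j = nat \<lfloor>r\<rfloor>"
      define n where "n = nat \<lfloor>t\<rfloor>"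
      have jn: "N \<le> j" "j \<le> n" "r \<in> {real j..real j + 1}" "t \<in> {real n..real n + 1}"
        using r t by (auto simp: j_def n_def le_nat_floor intro!: nat_mono floor_mono)
      have o1: "\<bar>W r \<omega> - W (real j) \<omega>\<bar> \<le> osc n" "\<bar>W t \<omega> - W (real n) \<omega>\<bar> \<le> osc n"
          "\<bar>W (real j + 1) \<omega> - W (real j) \<omega>\<bar> \<le> osc n" "3 * osc n \<le> z n"
        using N(1)[of j r] N(1)[of n t] N(1)[of j "real j + 1"] N(3)[of n] jn o_mono[OF jn(2)] by auto
      have "W r \<omega> - W t \<omega> \<le> \<beta> n * (t - r) + 2 * z n"
      proof (cases "j = n")
        case True
        have "0 \<le> \<beta> n * (t - r)" using pos(2)[of n] t by simp
        moreover have "0 < z n" by (rule pos)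
        moreover have "0 \<le> osc n" using K(1) by (simp add: osc_def)
        ultimately show ?thesis using o1[unfolded True] by linarith
      next
        case False
        then have k: "Suc j \<le> n" using jn by simp
        have "W (real (Suc j)) \<omega> - W (real n) \<omega> \<le> \<beta> n * real (n - Suc j) + z n"
          using N(2)[of n "Suc j"] k jn by auto
        moreover have "\<beta> n * real (n - Suc j) \<le> \<beta> n * (t - r)"
          using jn k by (intro mult_left_mono pos) (auto simp: of_nat_diff)
        ultimately show ?thesis using o1 by (simp add: add.commute)
      qed
      then show "W r \<omega> - W t \<omega> \<le> \<beta> (nat \<lfloor>t\<rfloor>) * (t - r) + 2 * z (nat \<lfloor>t\<rfloor>)"
        by (simp add: n_def)
    qed
  qed
qed

text \<open>
  After rescaling, all these events have the same probability \<open>p > 0\<close> under the standard normal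
  law, and they are independent: \<open>L\<close> consecutive failures have probability \<open>(1 - p) ^ L\<close>.
\<close>

lemma infinitely_many_drops:
  fixes u v :: "nat \<Rightarrow> real"
  assumes uv: "\<And>k. 0 \<le> u k" "\<And>k. u k < v k" "\<And>k. v k < u (Suc k)"
  shows "AE \<omega> in M. \<forall>N. \<exists>k\<ge>N. W (v k) \<omega> - W (u k) \<omega> \<le> - m * sqrt (v k - u k)"
proof -
  define D where "D k = {\<omega> \<in> space M. W (v k) \<omega> - W (u k) \<omega> \<le> - m * sqrt (v k - u k)}" for k
  define p where "p = measure (density lborel std_normal_density) {..- m}"
  interpret N: prob_space "density lborel std_normal_density"
    by (rule prob_space_normal_density) simp
  have rv: "(\<lambda>\<omega>. W (v k) \<omega> - W (u k) \<omega>) \<in> borel_measurable M" for k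
    using uv(1)[of k] uv(2)[of k] by (intro random_variable_increment) auto
  have D: "D k \<in> events" for k
    using rv[of k] unfolding D_def by measurable
  have prob_D: "prob (D k) = p" for k
  proof -
    have \<sigma>: "0 < sqrt (v k - u k)" using uv(2)[of k] by simp
    have dist: "distributed M lborel (\<lambda>\<omega>. (W (v k) \<omega> - W (u k) \<omega> - 0) / sqrt (v k - u k)) (\<lambda>x. ennreal (std_normal_density x))"
      using normal_increments[OF uv(1,2)[of k]] unfolding normal_standard_normal_convert[OF \<sigma>] .
    have "D k = (\<lambda>\<omega>. (W (v k) \<omega> - W (u k) \<omega> - 0) / sqrt (v k - u k)) -` {..- m} \<inter> space M"
      using \<sigma> by (auto simp: D_def pos_divide_le_eq)
    then have "emeasure M (D k) = emeasure (density lborel std_normal_density) {..- m}"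
      using distributed_emeasure[OF dist, of "{..- m}"] by (simp add: emeasure_density)
    then show ?thesis by (simp add: p_def measure_def)
  qed
  have "p \<noteq> 0"
  proof
    assume "p = 0"
    then have "emeasure (density lborel std_normal_density) {..- m} = 0"
      by (simp add: p_def N.emeasure_eq_measure)
    then have "(\<integral>\<^sup>+x. ennreal (std_normal_density x) * indicator {..- m} x \<partial>lborel) = 0"
      by (simp add: emeasure_density)
    then have "AE x in lborel. ennreal (std_normal_density x) * indicator {..- m} x = 0"
      by (subst (asm) nn_integral_0_iff_AE) auto
    moreover have "std_normal_density x \<noteq> 0" for x
      using normal_density_pos[OF zero_less_one, of 0 x] by linarith
    ultimately have "AE x in lborel. x \<notin> {..- m}"
      by (auto elim!: eventually_mono split: split_indicator_asm)
    then have "emeasure lborel {..- m} = 0"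
      by (subst (asm) AE_iff_measurable[of "{..- m}"]) auto
    then have "{..- m} \<in> null_sets lborel" by auto
    then have "{- m - 1..- m} \<in> null_sets lborel"
      by (rule null_sets_subset) auto
    then show False by auto
  qed
  then have p: "0 < p" "p \<le> 1" using N.prob_le_1 by (auto simp: p_def measure_le_0_iff order_less_le)
  \<comment> \<open>The intervals \<open>[u k, v k]\<close> are the even ones in the partition by \<open>u 0 < v 0 < u 1 < v 1\<close>.\<close>
  define \<tau> where "\<tau> i = (if even i then u (i div 2) else v (i div 2))" for i
  have mono: "strict_mono \<tau>"
  proof (rule strict_mono_Suc_iff[THEN iffD2], rule allI)
    fix n show "\<tau> n < \<tau> (Suc n)"
      using uv(2)[of "n div 2"] uv(3)[of "n div 2"] by (auto simp: \<tau>_def elim!: oddE)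
  qed
  have none: "prob (\<Inter>k\<in>{N..<N+L}. space M - D k) = (1 - p) ^ L" if "L > 0" for N L
  proof -
    define J where "J = (\<lambda>k. 2 * k) ` {N..<N+L}"
    define Y where "Y i \<omega> = W (\<tau> (Suc i)) \<omega> - W (\<tau> i) \<omega>" for i \<omega>
    define B where "B i = {y. \<not> y \<le> - m * sqrt (\<tau> (Suc i) - \<tau> i)}" for i
    have Y: "Y (2 * k) -` B (2 * k) \<inter> space M = space M - D k" for k
      by (auto simp: Y_def B_def \<tau>_def D_def)
    have "indep_vars (\<lambda>_. borel) Y {..<2 * (N + L)}"
    proof -
      have "Y = (\<lambda>i \<omega>. W (\<tau> (Suc i)) \<omega> - W (\<tau> i) \<omega>)"
        by (intro ext) (simp only: Y_def)
      moreover have "0 \<le> \<tau> 0" by (simp add: \<tau>_def uv)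
      ultimately show ?thesis using indep_increments[OF _ mono] by simp
    qed
    then have "prob (\<Inter>i\<in>J. Y i -` B i \<inter> space M) = (\<Prod>i\<in>J. prob (Y i -` B i \<inter> space M))"
      by (rule indep_varsD) (use that in \<open>auto simp: J_def B_def\<close>)
    moreover have "(\<Inter>i\<in>J. Y i -` B i \<inter> space M) = (\<Inter>k\<in>{N..<N+L}. space M - D k)"
      unfolding J_def image_image Y by (rule refl)
    moreover have "(\<Prod>i\<in>J. prob (Y i -` B i \<inter> space M)) = (\<Prod>k\<in>{N..<N+L}. prob (space M - D k))"
      unfolding J_def by (subst prod.reindex) (auto simp: inj_on_def Y)
    ultimately have "prob (\<Inter>k\<in>{N..<N+L}. space M - D k) = (\<Prod>k\<in>{N..<N+L}. prob (space M - D k))"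
      by simp
    also have "\<dots> = (\<Prod>k\<in>{N..<N+L}. 1 - p)"
      by (simp add: prob_compl[OF D] prob_D)
    finally show ?thesis by simp
  qed
  have "AE \<omega> in M. \<exists>k\<ge>N. \<omega> \<in> D k" for N
  proof -
    define S where "S = (\<Inter>k\<in>{N..}. space M - D k)"
    have S: "S \<in> events" unfolding S_def using D by (intro sets.countable_INT) auto
    have "prob S \<le> (1 - p) ^ L" if "L > 0" for L
    proof -
      have "prob S \<le> prob (\<Inter>k\<in>{N..<N+L}. space M - D k)"
        unfolding S_def using D that by (intro finite_measure_mono INF_superset_mono sets.finite_INT) auto
      then show ?thesis using none[OF that] by simp
    qed
    moreover have "(\<lambda>L. (1 - p) ^ L) \<longlonglongrightarrow> 0" using p by (intro LIMSEQ_power_zero) auto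
    ultimately have "prob S \<le> 0"
      by (intro LIMSEQ_le_const[where X = "\<lambda>L. (1 - p) ^ L"]) (auto intro: exI[of _ 1])
    then have "S \<in> null_sets M"
      using S by (simp add: null_sets_def emeasure_eq_measure measure_le_0_iff)
    then show ?thesis
      by (rule AE_I') (auto simp: S_def)
  qed
  then have "AE \<omega> in M. \<forall>N. \<exists>k\<ge>N. \<omega> \<in> D k" by (simp add: AE_all_countable)
  then show ?thesis by (rule AE_mp) (auto intro!: AE_I2 simp: D_def)
qed

end

section \<open>Distance of the diffusion to the boundary\<close>

text \<open>
  Away from \<open>1\<close> and above \<open>f / 2\<close>, nothing pushes the path up but the noise and a drift of at most
  \<open>2 powr \<bar>\<gamma>\<bar> \<le> 2\<close> times its value at the boundary, so a drop of the noise is felt.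
\<close>

lemma (in slow_reflected_path) deep_excursion:
  assumes "s \<le> u" "u \<le> v" "\<gamma> \<le> 0" and near: "\<And>y. y \<in> {u..v} \<Longrightarrow> f y / 2 \<le> X y \<and> 1 < X y"
  shows "- (W v - W u) - 2 * (v - u) * f u powr \<gamma> \<le> f v - X v"
proof -
  have "integral {u..v} (\<lambda>y. X y powr \<gamma>) \<le> integral {u..v} (\<lambda>y. 2 * f u powr \<gamma>)"
  proof (rule integral_le)
    show "(\<lambda>y. X y powr \<gamma>) integrable_on {u..v}" by (rule drift_integrable) (rule assms)
    fix y assume y: "y \<in> {u..v}"
    have "X y powr \<gamma> \<le> 2 powr \<bar>\<gamma>\<bar> * f y powr \<gamma>"
      using drift_near_boundary(2)[of y] near[OF y] y assms(1) by simp
    also have "\<dots> \<le> 2 powr 1 * f u powr \<gamma>"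
      using gamma assms y s_nonneg f_gt_1[of u] f_mono'[of u y]
      by (intro mult_mono powr_mono powr_mono2') auto
    finally show "X y powr \<gamma> \<le> 2 * f u powr \<gamma>" by simp
  qed auto
  moreover have "X v - X u \<le> W v - W u + integral {u..v} (\<lambda>y. X y powr \<gamma>)"
    using near by (intro path_increment_le assms(1,2)) auto
  moreover have "X u \<le> f u" "f u \<le> f v"
    using range_path[OF assms(1)] f_mono'[of u v] assms s_nonneg by auto
  moreover have "integral {u..v} (\<lambda>y. 2 * f u powr \<gamma>) = 2 * (v - u) * f u powr \<gamma>"
    using assms(2) by simp
  ultimately show ?thesis by linarith
qed

locale slow_reflected_diffusion =
  reflected_diffusion M W "\<lambda>y. y powr \<gamma>" f s x X L1 Lf + slow_boundary f f' \<gamma>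
  for M :: "'a measure" and W :: "real \<Rightarrow> 'a \<Rightarrow> real" and f f' :: "real \<Rightarrow> real"
    and \<gamma> s x :: real and X L1 Lf :: "real \<Rightarrow> 'a \<Rightarrow> real" +
  assumes s_nonneg: "0 \<le> s"
begin

lemma AE_path:
  "AE \<omega> in M. slow_reflected_path f f' (\<lambda>t. W t \<omega>) (\<lambda>t. X t \<omega>) (\<lambda>t. L1 t \<omega>) (\<lambda>t. Lf t \<omega>) \<gamma> s x"
  using continuous_X range_X X_eq local_time_1 local_time_f
proof eventually_elim
  case (elim \<omega>)
  have "continuous_on {1..} (\<lambda>y::real. y powr \<gamma>)" by (auto intro!: continuous_intros)
  then have "reflected_path (\<lambda>y. y powr \<gamma>) f (\<lambda>t. W t \<omega>) (\<lambda>t. X t \<omega>) (\<lambda>t. L1 t \<omega>) (\<lambda>t. Lf t \<omega>) s x"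
    using elim by (intro reflected_path.intro) auto
  then show ?case
    by (intro slow_reflected_path.intro slow_boundary_axioms slow_reflected_path_axioms.intro s_nonneg)
qed

text \<open>
  The condition \<open>z_drift\<close> is what the drawdown estimate needs with slope \<open>f powr \<gamma>\<close>, and
  \<open>z_noise\<close> absorbs the oscillation of \<open>W\<close> between integer times.
\<close>

theorem distance_to_boundary:
  fixes z :: "real \<Rightarrow> real"
  assumes z_pos: "\<And>t. 0 \<le> t \<Longrightarrow> 0 < z t" and z_mono: "\<And>r t. 0 \<le> r \<Longrightarrow> r \<le> t \<Longrightarrow> z r \<le> z t"
    and z_drift: "filterlim (\<lambda>t. z t * f t powr \<gamma> / ln t) at_top at_top"
    and z_noise: "filterlim (\<lambda>t. z t / sqrt (ln (t + 2))) at_top at_top"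
    and z_small: "((\<lambda>t. z t / f t) \<longlongrightarrow> 0) at_top"
  shows "AE \<omega> in M. \<forall>\<^sub>F t in at_top. f t - X t \<omega> \<le> z t"
proof -
  obtain \<kappa> N1 where \<kappa>: "\<kappa> > 0" "N1 \<ge> 0" "continuous_on {N1..} f"
    "\<And>r t. r \<ge> N1 \<Longrightarrow> t \<ge> r \<Longrightarrow>
       f t - f r + \<kappa> * (t - r) * f t powr \<gamma> \<le> 2 powr - \<bar>\<gamma>\<bar> * integral {r..t} (\<lambda>u. f u powr \<gamma>)"
    using drift_beats_boundary[of "2 powr - \<bar>\<gamma>\<bar>"] by auto
  obtain K N2 where K: "K \<ge> 1" "N2 \<ge> 0" "\<And>t. t \<ge> N2 \<Longrightarrow> f (2 * t) \<le> K * f t"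
    using doubling_constant by blast
  \<comment> \<open>The slope is frozen at the last integer time; by doubling, \<open>f\<close> has changed since then at most by the
    factor \<open>K\<close>, which costs the factor \<open>K powr - \<bar>\<gamma>\<bar>\<close>.\<close>
  define c where "c = \<kappa> * K powr - \<bar>\<gamma>\<bar>"
  have c: "c > 0" using \<kappa>(1) K(1) by (simp add: c_def)
  define \<beta> where "\<beta> n = c * f (real n) powr \<gamma>" for n
  have \<beta>_le: "\<beta> (nat \<lfloor>t\<rfloor>) \<le> \<kappa> * f t powr \<gamma>" if t: "t \<ge> N2 + 1" for t
  proof -
    define n where "n = real (nat \<lfloor>t\<rfloor>)"
    have "1 \<le> \<lfloor>t\<rfloor>" using t K(2) by (simp add: le_floor_iff)
    then have "n = real_of_int \<lfloor>t\<rfloor>" "1 \<le> real_of_int \<lfloor>t\<rfloor>" by (auto simp: n_def)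
    then have n: "N2 \<le> n" "0 \<le> n" "n \<le> t" "t \<le> 2 * n"
      using t K(2) by linarith+
    have f_n: "1 < f n" "f n \<le> f t" "f t \<le> K * f n"
      using n f_gt_1[of n] f_mono'[of n t] f_mono'[of t "2 * n"] K(3)[of n] by auto
    have "K powr - \<bar>\<gamma>\<bar> * f n powr \<gamma> \<le> f t powr \<gamma>"
    proof (cases "\<gamma> \<ge> 0")
      case True
      have "K powr - \<bar>\<gamma>\<bar> * f n powr \<gamma> \<le> 1 * f t powr \<gamma>"
        using f_n True K(1) powr_mono[of "- \<bar>\<gamma>\<bar>" 0 K] by (intro mult_mono powr_mono2) auto
      then show ?thesis by simp
    next
      case False
      have "(K * f n) powr \<gamma> \<le> f t powr \<gamma>" using f_n False by (intro powr_mono2') auto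
      then show ?thesis using K(1) f_n False by (simp add: powr_mult)
    qed
    then have "\<kappa> * (K powr - \<bar>\<gamma>\<bar> * f n powr \<gamma>) \<le> \<kappa> * f t powr \<gamma>"
      using \<kappa>(1) by (intro mult_left_mono) auto
    then show ?thesis by (simp add: \<beta>_def c_def n_def mult.assoc)
  qed
  have "AE \<omega> in M. \<exists>N. \<forall>r\<ge>N. \<forall>t\<ge>r. W r \<omega> - W t \<omega>
      \<le> \<beta> (nat \<lfloor>t\<rfloor>) * (t - r) + 2 * (z (real (nat \<lfloor>t\<rfloor>)) / 2)"
  proof (rule drawdown)
    show "0 < z (real n) / 2" for n using z_pos[of "real n"] by simp
    show "0 \<le> \<beta> n" for n using c by (simp add: \<beta>_def)
    have "filterlim (\<lambda>n. z (real n) * f (real n) powr \<gamma> / ln (real n)) at_top sequentially"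
      by (rule filterlim_compose[OF z_drift filterlim_real_sequentially])
    then have "\<forall>\<^sub>F n in sequentially. 4 / c \<le> z (real n) * f (real n) powr \<gamma> / ln (real n)"
      by (simp add: filterlim_at_top)
    then show "\<forall>\<^sub>F n in sequentially. 2 * ln (real n) \<le> \<beta> n * (z (real n) / 2)"
      using eventually_ge_at_top[of 2]
    proof eventually_elim
      case (elim n)
      then have "ln (real n) > 0" by simp
      then have "4 / c * ln (real n) \<le> z (real n) * f (real n) powr \<gamma>"
        using elim(1) by (simp only: pos_le_divide_eq)
      then have "4 * ln (real n) \<le> c * (z (real n) * f (real n) powr \<gamma>)"
        using c by (simp add: field_simps)
      then show ?case by (simp add: \<beta>_def mult_ac)
    qed
    fix C
    have "filterlim (\<lambda>n. z (real n) / sqrt (ln (real n + 2))) at_top sequentially"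
      by (rule filterlim_compose[OF z_noise filterlim_real_sequentially])
    then have "\<forall>\<^sub>F n in sequentially. 2 * C \<le> z (real n) / sqrt (ln (real n + 2))"
      by (simp add: filterlim_at_top)
    then show "\<forall>\<^sub>F n in sequentially. C * sqrt (ln (real n + 2)) \<le> z (real n) / 2"
    proof eventually_elim
      case (elim n)
      have "0 < sqrt (ln (real n + 2))" by simp
      then have "2 * C * sqrt (ln (real n + 2)) \<le> z (real n)"
        using elim by (simp only: pos_le_divide_eq)
      then show ?case by simp
    qed
  qed
  moreover have "AE \<omega> in M. ((\<lambda>t. W t \<omega> / t powr 1) \<longlongrightarrow> 0) at_top"
    by (rule growth_less_than_power) simp
  moreover have "AE \<omega> in M. ((\<lambda>t. W t \<omega> / t powr (1 / (1 - \<gamma>))) \<longlongrightarrow> 0) at_top"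
    by (rule growth_less_than_power) (use gamma in \<open>simp add: field_simps\<close>)
  ultimately show ?thesis
    using AE_path
  proof eventually_elim
    case (elim \<omega>)
    interpret slow_reflected_path f f' "\<lambda>t. W t \<omega>" "\<lambda>t. X t \<omega>" "\<lambda>t. L1 t \<omega>" "\<lambda>t. Lf t \<omega>" \<gamma> s x
      by (rule elim)
    have "((\<lambda>t. W t \<omega> / t) \<longlongrightarrow> 0) at_top"
      using elim(2) by (rule Lim_transform_eventually)
        (auto intro: eventually_mono[OF eventually_gt_at_top[of 0]])
    note hits = reaches_boundary[OF this elim(3)]
    obtain N where N: "\<And>r t. r \<ge> N \<Longrightarrow> t \<ge> r \<Longrightarrow>
        W r \<omega> - W t \<omega> \<le> \<beta> (nat \<lfloor>t\<rfloor>) * (t - r) + z (real (nat \<lfloor>t\<rfloor>))"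
      using elim(1) by auto
    show ?case
    proof (rule stays_near_boundary[OF \<kappa>(2,3,4) _ _ hits])
      fix r t assume r: "r \<ge> max N (N2 + 1)" "t \<ge> r"
      have "\<beta> (nat \<lfloor>t\<rfloor>) * (t - r) \<le> \<kappa> * f t powr \<gamma> * (t - r)"
        using r by (intro mult_right_mono \<beta>_le) auto
      moreover have "z (real (nat \<lfloor>t\<rfloor>)) \<le> z t" using r K(2) by (intro z_mono) auto
      ultimately show "W r \<omega> - W t \<omega> \<le> \<kappa> * (t - r) * f t powr \<gamma> + z t"
        using N[of r t] r by (simp add: mult_ac)
    next
      show "\<forall>\<^sub>F t in at_top. z t \<le> f t / 4"
      proof -
        have "\<forall>\<^sub>F t in at_top. z t / f t < 1 / 4"
          using order_tendstoD(2)[OF z_small, of "1/4"] by simp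
        then show ?thesis
          using eventually_ge_at_top[of 0]
        proof eventually_elim
          case (elim t)
          then show ?case using f_gt_1[of t] by (simp add: field_simps)
        qed
      qed
    qed
  qed
qed

lemma ratio_tendsto_1:
  assumes "AE \<omega> in M. \<forall>\<^sub>F t in at_top. f t - X t \<omega> \<le> z t" and z_small: "((\<lambda>t. z t / f t) \<longlongrightarrow> 0) at_top"
  shows "AE \<omega> in M. ((\<lambda>t. X t \<omega> / f t) \<longlongrightarrow> 1) at_top"
  using assms(1) range_X
proof eventually_elim
  case (elim \<omega>)
  from elim(1) have "\<forall>\<^sub>F t in at_top. norm (X t \<omega> / f t - 1) \<le> z t / f t"
    using eventually_ge_at_top[of s]
  proof eventually_elim
    case (elim t)
    have "f t > 1" using elim s_nonneg by (intro f_gt_1) auto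
    moreover have "X t \<omega> \<le> f t" using \<open>\<forall>t\<ge>s. X t \<omega> \<in> {1..f t}\<close> elim by auto
    ultimately have "norm (X t \<omega> / f t - 1) = (f t - X t \<omega>) / f t"
      by (simp add: diff_divide_distrib)
    also have "\<dots> \<le> z t / f t" using elim \<open>f t > 1\<close> by (intro divide_right_mono) auto
    finally show ?case .
  qed
  then have "((\<lambda>t. X t \<omega> / f t - 1) \<longlongrightarrow> 0) at_top"
    using z_small by (rule Lim_null_comparison)
  then show ?case by (simp add: LIM_zero_iff)
qed

lemma scaled_distance_Limsup_0:
  assumes "AE \<omega> in M. \<forall>\<^sub>F t in at_top. f t - X t \<omega> \<le> z t" and z: "((\<lambda>t. z t / t powr q) \<longlongrightarrow> 0) at_top"
  shows "AE \<omega> in M. Limsup at_top (\<lambda>t. ereal ((f t - X t \<omega>) / t powr q)) = 0"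
  using assms(1) range_X
proof eventually_elim
  case (elim \<omega>)
  from elim(1) have "\<forall>\<^sub>F t in at_top. norm ((f t - X t \<omega>) / t powr q) \<le> z t / t powr q"
    using eventually_ge_at_top[of s]
  proof eventually_elim
    case (elim t)
    have "X t \<omega> \<le> f t" using \<open>\<forall>t\<ge>s. X t \<omega> \<in> {1..f t}\<close> elim by auto
    then show ?case using elim by (simp add: divide_right_mono)
  qed
  then have "((\<lambda>t. (f t - X t \<omega>) / t powr q) \<longlongrightarrow> 0) at_top"
    using z by (rule Lim_null_comparison)
  then have "((\<lambda>t. ereal ((f t - X t \<omega>) / t powr q)) \<longlongrightarrow> ereal 0) at_top" by simp
  from lim_imp_Limsup[OF _ this] show ?case by (simp add: zero_ereal_def)
qed

text \<open>
  The drops are sought over the intervals from \<open>u k = 2 ^ Suc k\<close> to \<open>u k + u k powr (2 * a)\<close>,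
  with \<open>a = - l * \<gamma>\<close>. They are disjoint because \<open>2 * a < 1\<close>, which follows from
  \<open>l < 1 / (1 - \<gamma>)\<close>. Over such an interval the standard deviation of the noise and the drift,
  \<open>u powr (2 * a) * u powr (- a)\<close>, both equal \<open>u powr a\<close>. That \<open>X / f\<close> tends to \<open>1\<close> keeps
  the path above \<open>f / 2\<close> there, so that the drift is at most twice as large.
\<close>

theorem scaled_distance_Limsup_infinite:
  assumes f_eq: "\<forall>\<^sub>F t in at_top. f t = t powr l" and l: "0 < l" "l < 1 / (1 - \<gamma>)" and "\<gamma> \<le> 0"
    and ratio: "AE \<omega> in M. ((\<lambda>t. X t \<omega> / f t) \<longlongrightarrow> 1) at_top"
  shows "AE \<omega> in M. Limsup at_top (\<lambda>t. ereal ((f t - X t \<omega>) / t powr (- l * \<gamma>))) = \<infinity>"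
proof -
  define a where "a = - l * \<gamma>"
  have a: "0 \<le> a" "2 * a < 1"
  proof -
    show "0 \<le> a" using l \<open>\<gamma> \<le> 0\<close> by (simp add: a_def mult_nonneg_nonpos)
    have "l * (1 - \<gamma>) < 1" using l gamma by (simp add: field_simps)
    moreover have "l * - \<gamma> \<le> l * 1" using l gamma by (intro mult_left_mono) auto
    ultimately show "2 * a < 1" by (simp add: a_def algebra_simps)
  qed
  define u where "u k = (2 :: real) ^ Suc k" for k
  define v where "v k = u k + u k powr (2 * a)" for k
  have u: "2 \<le> u k" for k
    using power_increasing[of 1 "Suc k" "2 :: real"] by (simp only: u_def) simp
  have uv: "u k < v k" "v k < 2 * u k" "sqrt (v k - u k) = u k powr a" for k
  proof -
    show "u k < v k" using u[of k] by (simp add: v_def)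
    have "u k powr (2 * a) < u k powr 1" using u[of k] a by (intro powr_less_mono) auto
    then show "v k < 2 * u k" using u[of k] by (simp add: v_def)
    have "u k powr (2 * a) = (u k powr a)\<^sup>2" by (simp add: power2_eq_square flip: powr_add)
    then show "sqrt (v k - u k) = u k powr a" by (simp add: v_def)
  qed
  have "AE \<omega> in M. \<forall>N. \<exists>k\<ge>N. W (v k) \<omega> - W (u k) \<omega> \<le> - real m * sqrt (v k - u k)" for m :: nat
  proof (rule infinitely_many_drops)
    show "v k < u (Suc k)" for k using uv(2)[of k] by (simp add: u_def)
    show "0 \<le> u k" for k using u[of k] by simp
  qed (rule uv)
  then have "AE \<omega> in M. \<forall>m :: nat. \<forall>N. \<exists>k\<ge>N. W (v k) \<omega> - W (u k) \<omega> \<le> - real m * sqrt (v k - u k)"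
    by (simp add: AE_all_countable)
  then show ?thesis
    using ratio AE_path
  proof eventually_elim
    case (elim \<omega>)
    interpret slow_reflected_path f f' "\<lambda>t. W t \<omega>" "\<lambda>t. X t \<omega>" "\<lambda>t. L1 t \<omega>" "\<lambda>t. Lf t \<omega>" \<gamma> s x
      by (rule elim)
    have "filterlim (\<lambda>t. t powr l) at_top at_top" using l by real_asymp
    then have "\<forall>\<^sub>F t in at_top. t powr l > 2" by (simp add: filterlim_at_top_dense)
    moreover have "\<forall>\<^sub>F t in at_top. X t \<omega> / f t > 1 / 2"
      using order_tendstoD(1)[OF elim(2), of "1/2"] by simp
    ultimately have "\<forall>\<^sub>F t in at_top. f t = t powr l \<and> f t / 2 \<le> X t \<omega> \<and> 1 < X t \<omega> \<and> s \<le> t"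
      using f_eq eventually_ge_at_top[of s]
    proof eventually_elim
      case (elim t)
      have "f t > 0" using f_gt_1[of t] elim(4) s_nonneg by linarith
      then have "f t / 2 < X t \<omega>" using elim(2) by (simp add: field_simps)
      then show ?case using elim by simp
    qed
    then obtain T where T: "\<And>t. t \<ge> T \<Longrightarrow> f t = t powr l \<and> f t / 2 \<le> X t \<omega> \<and> 1 < X t \<omega> \<and> s \<le> t"
      unfolding eventually_at_top_linorder by blast
    have far: "\<exists>t\<ge>S. C \<le> (f t - X t \<omega>) / t powr a" for C S :: real
    proof -
      define m where "m = nat \<lceil>2 * \<bar>C\<bar> + 2\<rceil>"
      have m: "2 * \<bar>C\<bar> + 2 \<le> real m" unfolding m_def by linarith
      obtain N where N: "max S T \<le> 2 ^ N" using real_arch_pow[of 2 "max S T"] by (auto intro: less_imp_le)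
      obtain k where k: "k \<ge> N" "W (v k) \<omega> - W (u k) \<omega> \<le> - real m * sqrt (v k - u k)"
        using elim(1) by blast
      have "(2 :: real) ^ N \<le> 2 ^ Suc k" using k(1) by (intro power_increasing) auto
      then have uk: "S \<le> u k" "T \<le> u k" using N by (auto simp: u_def)
      have "v k - u k = (u k powr a) * (u k powr a)"
        by (simp add: v_def flip: powr_add)
      moreover have "f (u k) powr \<gamma> = u k powr (- a)"
        using T[OF uk(2)] by (simp add: powr_powr a_def)
      moreover have "u k powr a * u k powr (- a) = 1" using u[of k] by (simp flip: powr_add)
      ultimately have cost: "(v k - u k) * f (u k) powr \<gamma> = u k powr a"
        by (simp add: mult.assoc)
      have "- (W (v k) \<omega> - W (u k) \<omega>) - 2 * (v k - u k) * f (u k) powr \<gamma> \<le> f (v k) - X (v k) \<omega>"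
      proof (rule deep_excursion)
        show "s \<le> u k" using T[OF uk(2)] by blast
        show "u k \<le> v k" using uv(1)[of k] by simp
        fix y assume "y \<in> {u k..v k}"
        then have "T \<le> y" using uk(2) by simp
        from T[OF this] show "f y / 2 \<le> X y \<omega> \<and> 1 < X y \<omega>" by blast
      qed (rule \<open>\<gamma> \<le> 0\<close>)
      then have "(real m - 2) * u k powr a \<le> f (v k) - X (v k) \<omega>"
        using k(2) cost unfolding uv(3) by (simp add: mult.assoc left_diff_distrib)
      moreover have "\<bar>C\<bar> * v k powr a \<le> (real m - 2) * u k powr a"
      proof -
        have "v k powr a \<le> (2 * u k) powr a"
          using uv(1,2)[of k] u[of k] a by (intro powr_mono2) auto
        also have "\<dots> = 2 powr a * u k powr a" using u[of k] by (simp add: powr_mult)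
        also have "\<dots> \<le> 2 powr 1 * u k powr a" using a by (intro mult_right_mono powr_mono) auto
        finally have "\<bar>C\<bar> * v k powr a \<le> \<bar>C\<bar> * (2 * u k powr a)" by (intro mult_left_mono) auto
        also have "\<dots> = (2 * \<bar>C\<bar>) * u k powr a" by simp
        also have "\<dots> \<le> (real m - 2) * u k powr a" using m by (intro mult_right_mono) auto
        finally show ?thesis .
      qed
      moreover have "C * v k powr a \<le> \<bar>C\<bar> * v k powr a" by (intro mult_right_mono) auto
      ultimately have "C * v k powr a \<le> f (v k) - X (v k) \<omega>" by linarith
      moreover have "0 < v k powr a" using u[of k] uv(1)[of k] by simp
      ultimately have "C \<le> (f (v k) - X (v k) \<omega>) / v k powr a"
        by (simp only: pos_le_divide_eq)
      then show ?thesis using uk(1) uv(1)[of k] by (intro exI[of _ "v k"]) auto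
    qed
    show ?case
    proof (rule ccontr)
      assume "\<not> ?thesis"
      then have "Limsup at_top (\<lambda>t. ereal ((f t - X t \<omega>) / t powr a)) < \<infinity>"
        by (simp add: a_def less_top)
      then obtain C where "Limsup at_top (\<lambda>t. ereal ((f t - X t \<omega>) / t powr a)) < ereal C"
        using less_PInf_Ex_of_nat by force
      then have "\<forall>\<^sub>F t in at_top. ereal ((f t - X t \<omega>) / t powr a) < ereal C"
        by (rule Limsup_lessD)
      then obtain S where "\<And>t. t \<ge> S \<Longrightarrow> (f t - X t \<omega>) / t powr a < C"
        unfolding eventually_at_top_linorder by auto
      then show False using far[of S C] by (meson not_le)
    qed
  qed
qed

end

section \<open>Logarithmic and power boundaries\<close>

lemma slow_boundaryI:
  assumes "-1 < \<gamma>" "\<gamma> < 1" "mono_on {0..} f" "f 0 > 1"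
    and eq: "\<forall>\<^sub>F t in at_top. f t = g t"
    and deriv: "\<forall>\<^sub>F t in at_top. (g has_real_derivative f' t) (at t)"
    and slow: "((\<lambda>t. f' t / g t powr \<gamma>) \<longlongrightarrow> 0) at_top"
    and doubling: "\<forall>\<^sub>F t in at_top. g (2 * t) \<le> K * g t"
    and small: "((\<lambda>t. g t / t powr (1 / (1 - \<gamma>))) \<longlongrightarrow> 0) at_top"
  shows "slow_boundary f f' \<gamma>"
proof
  show "\<forall>\<^sub>F t in at_top. (f has_real_derivative f' t) (at t)"
  proof -
    obtain T where T: "\<And>t. t \<ge> T \<Longrightarrow> f t = g t" using eq unfolding eventually_at_top_linorder by auto
    show ?thesis
      using deriv eventually_gt_at_top[of T]
    proof eventually_elim
      case (elim t)
      show ?case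
        by (rule has_field_derivative_transform_within_open[OF elim(1), of "{T<..}"])
          (use elim(2) T in auto)
    qed
  qed
  show "((\<lambda>t. f' t / f t powr \<gamma>) \<longlongrightarrow> 0) at_top"
    using slow by (rule Lim_transform_eventually) (use eq in eventually_elim, simp)
  show "((\<lambda>t. f t / t powr (1 / (1 - \<gamma>))) \<longlongrightarrow> 0) at_top"
    using small by (rule Lim_transform_eventually) (use eq in eventually_elim, simp)
  have "\<forall>\<^sub>F t in at_top. f (2 * t) = g (2 * t)"
    by (rule eventually_compose_filterlim[OF eq]) real_asymp
  with eq doubling have "\<forall>\<^sub>F t in at_top. f (2 * t) \<le> K * f t" by eventually_elim simp
  then show "\<exists>K. \<forall>\<^sub>F t in at_top. f (2 * t) \<le> K * f t" by blast
qed (use assms in auto)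

lemma slow_boundary_log_power:
  assumes gamma: "-1 < \<gamma>" "\<gamma> < 1" and f: "mono_on {0..} f" "f 0 > 1"
    and eq: "\<forall>\<^sub>F t in at_top. f t = ln t powr l" and l: "0 < l"
  shows "slow_boundary f (\<lambda>t. l * ln t powr (l - 1) / t) \<gamma>"
proof (rule slow_boundaryI[OF gamma f eq])
  show "\<forall>\<^sub>F t in at_top. ((\<lambda>t. ln t powr l) has_real_derivative l * ln t powr (l - 1) / t) (at t)"
    using eventually_gt_at_top[of 1]
    by eventually_elim (auto intro!: derivative_eq_intros simp: powr_diff field_simps)
  show "((\<lambda>t. l * ln t powr (l - 1) / t / (ln t powr l) powr \<gamma>) \<longlongrightarrow> 0) at_top"
    unfolding powr_powr by real_asymp
  have lim: "((\<lambda>t::real. ln (2 * t) powr l / ln t powr l) \<longlongrightarrow> 1) at_top" by real_asymp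
  have "\<forall>\<^sub>F t::real in at_top. ln (2 * t) powr l / ln t powr l < 2"
    using order_tendstoD(2)[OF lim, of 2] by simp
  then show "\<forall>\<^sub>F t::real in at_top. ln (2 * t) powr l \<le> 2 * ln t powr l"
    using eventually_gt_at_top[of 1] by eventually_elim (simp add: field_simps)
  have "1 / (1 - \<gamma>) > 0" using gamma by simp
  then show "((\<lambda>t. ln t powr l / t powr (1 / (1 - \<gamma>))) \<longlongrightarrow> 0) at_top" by real_asymp
qed

lemma slow_boundary_power:
  assumes gamma: "-1 < \<gamma>" "\<gamma> < 1" and f: "mono_on {0..} f" "f 0 > 1"
    and eq: "\<forall>\<^sub>F t in at_top. f t = t powr l" and l: "0 < l" "l < 1 / (1 - \<gamma>)"
  shows "slow_boundary f (\<lambda>t. l * t powr (l - 1)) \<gamma>"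
proof (rule slow_boundaryI[OF gamma f eq])
  show "\<forall>\<^sub>F t in at_top. ((\<lambda>t. t powr l) has_real_derivative l * t powr (l - 1)) (at t)"
    using eventually_gt_at_top[of 0] by eventually_elim (auto intro!: derivative_eq_intros)
  have neg: "l - 1 - l * \<gamma> < 0" using l gamma by (simp add: field_simps)
  have "((\<lambda>t. l * t powr (l - 1 - l * \<gamma>)) \<longlongrightarrow> l * 0) at_top"
    by (intro tendsto_intros tendsto_neg_powr neg filterlim_ident)
  then show "((\<lambda>t. l * t powr (l - 1) / (t powr l) powr \<gamma>) \<longlongrightarrow> 0) at_top"
    by (simp add: powr_powr powr_diff)
  show "\<forall>\<^sub>F t::real in at_top. (2 * t) powr l \<le> 2 powr l * t powr l"
    using eventually_gt_at_top[of 0] by eventually_elim (simp add: powr_mult)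
  have "((\<lambda>t::real. t powr (l - 1 / (1 - \<gamma>))) \<longlongrightarrow> 0) at_top"
    using l by (intro tendsto_neg_powr filterlim_ident) auto
  then show "((\<lambda>t. t powr l / t powr (1 / (1 - \<gamma>))) \<longlongrightarrow> 0) at_top"
    by (simp add: powr_diff)
qed

text \<open>
  A distance \<open>z = (ln t) powr q\<close> is admissible when \<open>q + l * \<gamma> > 1\<close> for the drawdown,
  \<open>q > 1 / 2\<close> for the oscillation, and \<open>q < l\<close>. The first and the last are compatible exactly
  when \<open>l * (1 + \<gamma>) > 1\<close>, and then \<open>l > 1 / 2\<close> since \<open>\<gamma> < 1\<close>.
\<close>

theorem log_power_boundary:
  assumes X: "reflected_diffusion M W (\<lambda>y. y powr \<gamma>) f s x X L1 Lf"
    and gamma: "-1 < \<gamma>" "\<gamma> < 1" and f: "mono_on {0..} f" "f 0 > 1" and s: "0 \<le> s"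
    and l: "l > 1 / (1 + \<gamma>)" and eq: "\<forall>\<^sub>F t in at_top. f t = ln t powr l"
  shows "AE \<omega> in M. ((\<lambda>t. X t \<omega> / f t) \<longlongrightarrow> 1) at_top"
proof -
  have l_pos: "0 < l" and l_half: "1 / 2 < l" and l_gamma: "1 - l * \<gamma> < l"
  proof -
    have "1 / 2 < 1 / (1 + \<gamma>)" using gamma by (simp add: field_simps)
    then show "1 / 2 < l" using l by simp
    then show "0 < l" by simp
    show "1 - l * \<gamma> < l" using l gamma by (simp add: field_simps)
  qed
  interpret slow_reflected_diffusion M W f "\<lambda>t. l * ln t powr (l - 1) / t" \<gamma> s x X L1 Lf
    by (intro slow_reflected_diffusion.intro X slow_boundary_log_power gamma f eq l_pos
      slow_reflected_diffusion_axioms.intro s)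
  obtain q where q: "max (1 / 2) (1 - l * \<gamma>) < q" "q < l"
    using dense[of "max (1 / 2) (1 - l * \<gamma>)" l] l_half l_gamma by auto
  define z where "z t = 1 + ln (1 + t) powr q" for t :: real
  have q': "q > 0" "q > 1 / 2" "q + l * \<gamma> - 1 > 0" using q by auto
  have small: "((\<lambda>t. z t / f t) \<longlongrightarrow> 0) at_top"
  proof (rule Lim_transform_eventually)
    show "((\<lambda>t. z t / ln t powr l) \<longlongrightarrow> 0) at_top"
      unfolding z_def using q' q(2) l_pos by real_asymp
  qed (use eq in eventually_elim, simp)
  have "AE \<omega> in M. \<forall>\<^sub>F t in at_top. f t - X t \<omega> \<le> z t"
  proof (rule distance_to_boundary)
    show "0 < z t" for t by (simp add: z_def add_pos_nonneg)
    show "z r \<le> z t" if "0 \<le> r" "r \<le> t" for r t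
      unfolding z_def using that q' by (intro add_left_mono powr_mono2) auto
    have "filterlim (\<lambda>t. ln t powr (q + l * \<gamma> - 1)) at_top at_top"
      using q' by real_asymp
    then show "filterlim (\<lambda>t. z t * f t powr \<gamma> / ln t) at_top at_top"
    proof (rule filterlim_at_top_mono)
      show "\<forall>\<^sub>F t in at_top. ln t powr (q + l * \<gamma> - 1) \<le> z t * f t powr \<gamma> / ln t"
        using eq eventually_gt_at_top[of 1]
      proof eventually_elim
        case (elim t)
        have "ln t powr (q + l * \<gamma> - 1) = ln t powr q * f t powr \<gamma> / ln t"
          using elim by (simp add: powr_diff powr_add powr_powr)
        also have "\<dots> \<le> z t * f t powr \<gamma> / ln t"
        proof -
          have "ln t powr q \<le> ln (1 + t) powr q" using elim q' by (intro powr_mono2) auto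
          then have "ln t powr q \<le> z t" by (simp add: z_def)
          then show ?thesis using elim by (intro divide_right_mono mult_right_mono) auto
        qed
        finally show ?case .
      qed
    qed
    show "filterlim (\<lambda>t. z t / sqrt (ln (t + 2))) at_top at_top"
      unfolding z_def using q' by real_asymp
  qed (rule small)
  from ratio_tendsto_1[OF this small] show ?thesis .
qed

text \<open>
  Here \<open>z = t powr p\<close> is admissible for all \<open>p\<close> between \<open>max 0 (- l * \<gamma>)\<close> and \<open>l\<close>; there are
  such \<open>p\<close> because \<open>- \<gamma> < 1\<close>.
\<close>

theorem power_boundary:
  assumes X: "reflected_diffusion M W (\<lambda>y. y powr \<gamma>) f s x X L1 Lf"
    and gamma: "-1 < \<gamma>" "\<gamma> < 1" and f: "mono_on {0..} f" "f 0 > 1" and s: "0 \<le> s"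
    and l: "0 < l" "l < 1 / (1 - \<gamma>)" and eq: "\<forall>\<^sub>F t in at_top. f t = t powr l"
  shows "q > max 0 (- l * \<gamma>) \<Longrightarrow>
      AE \<omega> in M. Limsup at_top (\<lambda>t. ereal ((f t - X t \<omega>) / t powr q)) = 0"
    and "\<gamma> \<le> 0 \<Longrightarrow>
      AE \<omega> in M. Limsup at_top (\<lambda>t. ereal ((f t - X t \<omega>) / t powr (- l * \<gamma>))) = \<infinity>"
    and "AE \<omega> in M. ((\<lambda>t. X t \<omega> / f t) \<longlongrightarrow> 1) at_top"
proof -
  interpret slow_reflected_diffusion M W f "\<lambda>t. l * t powr (l - 1)" \<gamma> s x X L1 Lf
    by (intro slow_reflected_diffusion.intro X slow_boundary_power gamma f eq l
      slow_reflected_diffusion_axioms.intro s)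
  have close: "AE \<omega> in M. \<forall>\<^sub>F t in at_top. f t - X t \<omega> \<le> 1 + t powr p"
    and small: "((\<lambda>t. (1 + t powr p) / f t) \<longlongrightarrow> 0) at_top"
    if p: "0 < p" "- l * \<gamma> < p" "p < l" for p
  proof -
    show small: "((\<lambda>t. (1 + t powr p) / f t) \<longlongrightarrow> 0) at_top"
    proof (rule Lim_transform_eventually)
      show "((\<lambda>t. (1 + t powr p) / t powr l) \<longlongrightarrow> 0) at_top" using p l by real_asymp
    qed (use eq in eventually_elim, simp)
    show "AE \<omega> in M. \<forall>\<^sub>F t in at_top. f t - X t \<omega> \<le> 1 + t powr p"
    proof (rule distance_to_boundary[OF _ _ _ _ small])
      show "0 < 1 + t powr p" for t :: real by (simp add: add_pos_nonneg)
      show "1 + r powr p \<le> 1 + t powr p" if "0 \<le> r" "r \<le> t" for r t :: real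
        using that p by (intro add_left_mono powr_mono2) auto
      have "filterlim (\<lambda>t::real. t powr (p + l * \<gamma>) / ln t) at_top at_top"
      proof -
        have "p + l * \<gamma> > 0" using p by simp
        then show ?thesis by real_asymp
      qed
      then show "filterlim (\<lambda>t. (1 + t powr p) * f t powr \<gamma> / ln t) at_top at_top"
      proof (rule filterlim_at_top_mono)
        show "\<forall>\<^sub>F t in at_top. t powr (p + l * \<gamma>) / ln t \<le> (1 + t powr p) * f t powr \<gamma> / ln t"
          using eq eventually_gt_at_top[of 1]
        proof eventually_elim
          case (elim t)
          have "t powr (p + l * \<gamma>) = t powr p * f t powr \<gamma>"
            using elim by (simp add: powr_add powr_powr)
          also have "\<dots> \<le> (1 + t powr p) * f t powr \<gamma>" by (intro mult_right_mono) auto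
          finally show ?case using elim by (intro divide_right_mono) auto
        qed
      qed
      show "filterlim (\<lambda>t. (1 + t powr p) / sqrt (ln (t + 2))) at_top at_top"
        using p by real_asymp
    qed
  qed
  have q0: "max 0 (- l * \<gamma>) < l"
    using mult_strict_left_mono[of "- \<gamma>" 1 l] l gamma by simp
  show ratio: "AE \<omega> in M. ((\<lambda>t. X t \<omega> / f t) \<longlongrightarrow> 1) at_top"
  proof -
    obtain p where "max 0 (- l * \<gamma>) < p" "p < l" using dense[OF q0] by auto
    then have p: "0 < p" "- l * \<gamma> < p" "p < l" by auto
    from ratio_tendsto_1[OF close[OF p] small[OF p]] show ?thesis .
  qed
  show "AE \<omega> in M. Limsup at_top (\<lambda>t. ereal ((f t - X t \<omega>) / t powr q)) = 0"
    if q: "q > max 0 (- l * \<gamma>)"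
  proof -
    obtain p where p: "max 0 (- l * \<gamma>) < p" "p < min q l" using dense[of "max 0 (- l * \<gamma>)" "min q l"] q q0 by auto
    then have p': "0 < p" "- l * \<gamma> < p" "p < l" and q': "0 < q" "p < q" by auto
    have "((\<lambda>t::real. (1 + t powr p) / t powr q) \<longlongrightarrow> 0) at_top"
      using p' q' by real_asymp
    from scaled_distance_Limsup_0[OF close[OF p'] this] show ?thesis .
  qed
  show "AE \<omega> in M. Limsup at_top (\<lambda>t. ereal ((f t - X t \<omega>) / t powr (- l * \<gamma>))) = \<infinity>" if "\<gamma> \<le> 0"
    using eq l that ratio by (rule scaled_distance_Limsup_infinite)
qed

theorem theorem5:
  fixes M :: "'a measure" and W X L1 Lf :: "real \<Rightarrow> 'a \<Rightarrow> real"
    and f :: "real \<Rightarrow> real" and \<gamma> s x :: real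
  assumes gamma: "\<gamma> \<in> {-1<..<1}"
    and f_mono: "mono_on {0..} f"
    and f_C3: "C_k_on 3 {0..} f"
    and f_0: "f 0 > 1"
    and s: "s \<ge> 0"
    and x: "x \<in> {1..f s}"
    and X: "reflected_diffusion M W (\<lambda>y. y powr \<gamma>) f s x X L1 Lf"
  shows
    "(\<forall>l. l > 1 / (1 + \<gamma>) \<and> (\<forall>\<^sub>F t in at_top. f t = ln t powr l) \<longrightarrow>
        (AE \<omega> in M. ((\<lambda>t. X t \<omega> / f t) \<longlongrightarrow> 1) at_top)) \<and>
     (\<forall>l. l \<in> {0<..<1 / (1 - \<gamma>)} \<and> (\<forall>\<^sub>F t in at_top. f t = t powr l) \<longrightarrow>
        (let q\<^sub>0 = (if \<gamma> \<ge> 0 then 0 else - l * \<gamma>) in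
          (\<forall>q>q\<^sub>0. AE \<omega> in M.
             Limsup at_top (\<lambda>t. ereal ((f t - X t \<omega>) / t powr q)) = 0) \<and>
          (\<gamma> \<in> {-1<..0} \<longrightarrow>
             (AE \<omega> in M. Limsup at_top (\<lambda>t. ereal ((f t - X t \<omega>) / t powr q\<^sub>0)) = \<infinity>)) \<and>
          (AE \<omega> in M. ((\<lambda>t. X t \<omega> / f t) \<longlongrightarrow> 1) at_top)))"
proof (intro conjI allI impI)
  have g: "-1 < \<gamma>" "\<gamma> < 1" using gamma by auto
  fix l :: real
  {
    assume "l > 1 / (1 + \<gamma>) \<and> (\<forall>\<^sub>F t in at_top. f t = ln t powr l)"
    then show "AE \<omega> in M. ((\<lambda>t. X t \<omega> / f t) \<longlongrightarrow> 1) at_top"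
      using log_power_boundary[OF X g f_mono f_0 s] by blast
  next
    assume l: "l \<in> {0<..<1 / (1 - \<gamma>)} \<and> (\<forall>\<^sub>F t in at_top. f t = t powr l)"
    then have l': "0 < l" "l < 1 / (1 - \<gamma>)" "\<forall>\<^sub>F t in at_top. f t = t powr l" by auto
    define q0 where "q0 = (if \<gamma> \<ge> 0 then 0 else - l * \<gamma>)"
    have q0: "q0 = max 0 (- l * \<gamma>)"
    proof (cases "\<gamma> \<ge> 0")
      case True
      then have "- l * \<gamma> \<le> 0" using l'(1) by simp
      then show ?thesis using True by (simp only: q0_def max_absorb1 if_True)
    next
      case False
      then have "0 \<le> - l * \<gamma>" using l'(1) by (simp add: mult_nonneg_nonpos)
      then show ?thesis using False by (simp only: q0_def max_absorb2 if_False)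
    qed
    have q0': "\<gamma> \<le> 0 \<Longrightarrow> q0 = - l * \<gamma>" by (auto simp: q0_def)
    show "let q\<^sub>0 = (if \<gamma> \<ge> 0 then 0 else - l * \<gamma>) in
          (\<forall>q>q\<^sub>0. AE \<omega> in M.
             Limsup at_top (\<lambda>t. ereal ((f t - X t \<omega>) / t powr q)) = 0) \<and>
          (\<gamma> \<in> {-1<..0} \<longrightarrow>
             (AE \<omega> in M. Limsup at_top (\<lambda>t. ereal ((f t - X t \<omega>) / t powr q\<^sub>0)) = \<infinity>)) \<and>
          (AE \<omega> in M. ((\<lambda>t. X t \<omega> / f t) \<longlongrightarrow> 1) at_top)"
      unfolding Let_def q0_def[symmetric]
    proof (intro conjI allI impI)
      fix q assume "q > q0"
      then show "AE \<omega> in M. Limsup at_top (\<lambda>t. ereal ((f t - X t \<omega>) / t powr q)) = 0"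
        unfolding q0 by (rule power_boundary(1)[OF X g f_mono f_0 s l'])
    next
      assume "\<gamma> \<in> {-1<..0}"
      then have "\<gamma> \<le> 0" by simp
      from power_boundary(2)[OF X g f_mono f_0 s l' this]
      show "AE \<omega> in M. Limsup at_top (\<lambda>t. ereal ((f t - X t \<omega>) / t powr q0)) = \<infinity>"
        unfolding q0'[OF \<open>\<gamma> \<le> 0\<close>] .
    next
      show "AE \<omega> in M. ((\<lambda>t. X t \<omega> / f t) \<longlongrightarrow> 1) at_top"
        by (rule power_boundary(3)[OF X g f_mono f_0 s l'])
    qed
  }
qed

end
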